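(* Let $\sigma$ be a connection on $B(\mathcal{H})^+$ with representing function $f:[0,\infty)\to[0,\infty)$ and associated measure $\mu$ on $[0,1]$. Then the following statements are equivalent: (1) $\sigma$ is right cancellable, i.e. for all $A>0$, $B\ge 0$, $C\ge 0$ in $B(\mathcal{H})$, $B\,\sigma\,A=C\,\sigma\,A$ implies $B=C$; (2) for all $A\ge 0$ and $B\ge 0$, $A\,\sigma\,I=B\,\sigma\,I$ implies $A=B$; (3) $\sigma$ is not a scalar multiple of the right-trivial mean, i.e. there is no $k\ge 0$ with $A\,\sigma\,B=kB$ for all $A,B\ge 0$; (4) the transpose of $f$ is injective; (5) $f$ is not a scalar multiple of the identity function $x\mapsto x$; (6) $\mu$ is not a scalar multiple of the Dirac measure $\delta_1$ at $1$.
   Context: $\mathcal{H}$ is a Hilbert space, $B(\mathcal{H})$ the bounded linear operators on it, $B(\mathcal{H})^+$ the positive (semidefinite) operators; $A\le B$ means $B-A\in B(\mathcal{H})^+$; $A>0$ means $A$ is strictly positive (positive and invertible). A connection is a binary operation $\sigma$ on $B(\mathcal{H})^+$ such that for all positive $A,B,C,D$: (M1) $A\le C$, $B\le D$ imply $A\,\sigma\,B\le C\,\sigma\,D$; (M2) $C(A\,\sigma\,B)C\le (CAC)\,\sigma\,(CBC)$; (M3) if $A_n\downarrow A$ and $B_n\downarrow B$ then $A_n\,\sigma\,B_n\downarrow A\,\sigma\,B$, where $A_n\downarrow A$ means $(A_n)$ is a decreasing sequence converging strongly to $A$. A function $f:[0,\infty)\to[0,\infty)$ is operator monotone if (with the continuous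 functional calculus, $f$ continuous) $A\le B$ implies $f(A)\le f(B)$ for all positive operators $A,B$ on every Hilbert space. Representing function (Kubo–Ando theorem, taken as known): for a connection $\sigma$ there is a unique operator monotone $f:[0,\infty)\to[0,\infty)$ with $f(x)I=I\,\sigma\,(xI)$ for all $x\ge 0$; $\sigma\mapsto f$ is a bijection, and $f(A)=I\,\sigma\,A$ for all $A\ge0$. Associated measure (taken as known): for a connection $\sigma$ there is a unique finite positive Borel measure $\mu$ on $[0,1]$ with $A\,\sigma\,B=\int_{[0,1]}A\,!_t\,B\,d\mu(t)$ for all $A,B\ge 0$; then $f(x)=\int_{[0,1]}(1\,!_t\,x)\,d\mu(t)$ for $x\ge0$. Here $A\,!_t\,B=[(1-t)A^{-1}+tB^{-1}]^{-1}$ for $A,B>0$, extended to $A,B\ge 0$ as the strong limit of $(A+\epsilon I)\,!_t\,(B+\epsilon I)$ as $\epsilon\downarrow 0$ (so $A\,!_0\,B=A$, $A\,!_1\,B=B$). The right-trivial mean is $(A,B)\mapsto B$. The transpose of $\sigma$ is the connection $(A,B)\mapsto B\,\sigma\,A$. The transpose of $f$ is $x\mapsto xf(1/x)$, $x>0$; it is (extended to $x=0$ by continuity) the representing function of the transpose of $\sigma$. *)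

theory Defs
  imports "HOL-Probability.Probability" "HOL-Computational_Algebra.Polynomial"
begin

section \<open>Complex Hilbert spaces\<close>

text \<open>The inner product is linear in its first argument. Definiteness follows from the
  axiom relating it to the norm.\<close>

class chilbert_space = real_normed_vector + complete_space +
  fixes scaleC :: "complex \<Rightarrow> 'a \<Rightarrow> 'a"  (infixr "*\<^sub>C" 75)
    and cinner :: "'a \<Rightarrow> 'a \<Rightarrow> complex"
  assumes scaleC_add_right: "a *\<^sub>C (x + y) = a *\<^sub>C x + a *\<^sub>C y"
    and scaleC_add_left: "(a + b) *\<^sub>C x = a *\<^sub>C x + b *\<^sub>C x"
    and scaleC_scaleC: "a *\<^sub>C b *\<^sub>C x = (a * b) *\<^sub>C x"
    and scaleR_eq_scaleC: "r *\<^sub>R x = complex_of_real r *\<^sub>C x"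
    and cinner_commute: "cinner x y = cnj (cinner y x)"
    and cinner_add_left: "cinner (x + y) z = cinner x z + cinner y z"
    and cinner_scaleC_left: "cinner (a *\<^sub>C x) y = a * cinner x y"
    and cinner_self: "cinner x x = complex_of_real ((norm x)\<^sup>2)"
begin

subclass banach ..

end

section \<open>Positive operators\<close>

text \<open>The type \<open>'a \<Rightarrow>\<^sub>L 'a\<close> consists of the bounded real-linear operators; the bounded
  operators on the complex Hilbert space are those that commute with complex scalars.\<close>

definition complex_linear_op :: "('a::chilbert_space \<Rightarrow>\<^sub>L 'a) \<Rightarrow> bool" where
  "complex_linear_op T \<longleftrightarrow> (\<forall>c x. T (c *\<^sub>C x) = c *\<^sub>C T x)"

definition positive_op :: "('a::chilbert_space \<Rightarrow>\<^sub>L 'a) \<Rightarrow> bool" where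
  "positive_op T \<longleftrightarrow> complex_linear_op T \<and>
     (\<forall>x. Im (cinner (T x) x) = 0 \<and> 0 \<le> Re (cinner (T x) x))"

definition loewner_le :: "('a::chilbert_space \<Rightarrow>\<^sub>L 'a) \<Rightarrow> ('a \<Rightarrow>\<^sub>L 'a) \<Rightarrow> bool"
    (infix "\<preceq>" 50) where
  "A \<preceq> B \<longleftrightarrow> positive_op (B - A)"

text \<open>Inverses of complex-linear operators are complex-linear, so invertibility may be
  expressed in \<open>'a \<Rightarrow>\<^sub>L 'a\<close>.\<close>

definition invertible_op :: "('a::chilbert_space \<Rightarrow>\<^sub>L 'a) \<Rightarrow> bool" where
  "invertible_op T \<longleftrightarrow> (\<exists>S. S o\<^sub>L T = id_blinfun \<and> T o\<^sub>L S = id_blinfun)"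

definition inverse_op :: "('a::chilbert_space \<Rightarrow>\<^sub>L 'a) \<Rightarrow> ('a \<Rightarrow>\<^sub>L 'a)" where
  "inverse_op T = (THE S. S o\<^sub>L T = id_blinfun \<and> T o\<^sub>L S = id_blinfun)"

definition strictly_positive_op :: "('a::chilbert_space \<Rightarrow>\<^sub>L 'a) \<Rightarrow> bool" where
  "strictly_positive_op T \<longleftrightarrow> positive_op T \<and> invertible_op T"

definition decreases_to :: "(nat \<Rightarrow> ('a::chilbert_space \<Rightarrow>\<^sub>L 'a)) \<Rightarrow> ('a \<Rightarrow>\<^sub>L 'a) \<Rightarrow> bool" where
  "decreases_to X A \<longleftrightarrow> (\<forall>n. X (Suc n) \<preceq> X n) \<and> (\<forall>x. (\<lambda>n. X n x) \<longlonglongrightarrow> A x)"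

section \<open>Connections\<close>

text \<open>The values of a connection outside the positive operators are irrelevant.\<close>

definition connection ::
    "(('a::chilbert_space \<Rightarrow>\<^sub>L 'a) \<Rightarrow> ('a \<Rightarrow>\<^sub>L 'a) \<Rightarrow> ('a \<Rightarrow>\<^sub>L 'a)) \<Rightarrow> bool" where
  "connection \<sigma> \<longleftrightarrow>
     (\<forall>A B. positive_op A \<longrightarrow> positive_op B \<longrightarrow> positive_op (\<sigma> A B)) \<and>
     (\<forall>A B C D. positive_op A \<longrightarrow> positive_op B \<longrightarrow> positive_op C \<longrightarrow> positive_op D \<longrightarrow>
        A \<preceq> C \<longrightarrow> B \<preceq> D \<longrightarrow> \<sigma> A B \<preceq> \<sigma> C D) \<and>
     (\<forall>A B C. positive_op A \<longrightarrow> positive_op B \<longrightarrow> positive_op C \<longrightarrow>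
        C o\<^sub>L \<sigma> A B o\<^sub>L C \<preceq> \<sigma> (C o\<^sub>L A o\<^sub>L C) (C o\<^sub>L B o\<^sub>L C)) \<and>
     (\<forall>X Y A B. (\<forall>n. positive_op (X n)) \<longrightarrow> (\<forall>n. positive_op (Y n)) \<longrightarrow>
        positive_op A \<longrightarrow> positive_op B \<longrightarrow> decreases_to X A \<longrightarrow> decreases_to Y B \<longrightarrow>
        decreases_to (\<lambda>n. \<sigma> (X n) (Y n)) (\<sigma> A B))"

definition right_cancellable ::
    "(('a::chilbert_space \<Rightarrow>\<^sub>L 'a) \<Rightarrow> ('a \<Rightarrow>\<^sub>L 'a) \<Rightarrow> ('a \<Rightarrow>\<^sub>L 'a)) \<Rightarrow> bool" where
  "right_cancellable \<sigma> \<longleftrightarrow>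
     (\<forall>A B C. strictly_positive_op A \<longrightarrow> positive_op B \<longrightarrow> positive_op C \<longrightarrow>
        \<sigma> B A = \<sigma> C A \<longrightarrow> B = C)"

section \<open>Operator monotone and representing functions\<close>

definition poly_op :: "real poly \<Rightarrow> ('a::chilbert_space \<Rightarrow>\<^sub>L 'a) \<Rightarrow> ('a \<Rightarrow>\<^sub>L 'a)" where
  "poly_op p A = (\<Sum>i\<le>degree p. coeff p i *\<^sub>R (((o\<^sub>L) A) ^^ i) id_blinfun)"

text \<open>Continuous functional calculus at a positive operator \<open>A\<close>, whose spectrum is contained
  in \<open>{0..norm A}\<close>: the common norm limit of \<open>p\<^sub>n(A)\<close> over all sequences of polynomials
  converging to \<open>f\<close> uniformly on that interval.\<close>

definition cfc :: "(real \<Rightarrow> real) \<Rightarrow> ('a::chilbert_space \<Rightarrow>\<^sub>L 'a) \<Rightarrow> ('a \<Rightarrow>\<^sub>L 'a)" where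
  "cfc f A = (THE T. \<forall>p. uniform_limit {0..norm A} (\<lambda>n. poly (p n)) f sequentially \<longrightarrow>
                        (\<lambda>n. poly_op (p n) A) \<longlonglongrightarrow> T)"

text \<open>A function \<open>[0,\<infinity>) \<rightarrow> [0,\<infinity>)\<close> is represented by a function on the reals whose values at
  negative arguments are irrelevant. Since HOL cannot quantify over types, monotonicity is
  stated for the operators on one Hilbert space, passed as a type argument.\<close>

definition operator_monotone :: "'a::chilbert_space itself \<Rightarrow> (real \<Rightarrow> real) \<Rightarrow> bool" where
  "operator_monotone _ f \<longleftrightarrow>
     (\<forall>x\<ge>0. 0 \<le> f x) \<and> continuous_on {0..} f \<and>
     (\<forall>A B :: 'a \<Rightarrow>\<^sub>L 'a. positive_op A \<longrightarrow> positive_op B \<longrightarrow> A \<preceq> B \<longrightarrow> cfc f A \<preceq> cfc f B)"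

definition representing_function ::
    "(('a::chilbert_space \<Rightarrow>\<^sub>L 'a) \<Rightarrow> ('a \<Rightarrow>\<^sub>L 'a) \<Rightarrow> ('a \<Rightarrow>\<^sub>L 'a)) \<Rightarrow> (real \<Rightarrow> real) \<Rightarrow> bool" where
  "representing_function \<sigma> f \<longleftrightarrow> operator_monotone TYPE('a) f \<and>
     (\<forall>x\<ge>0. f x *\<^sub>R id_blinfun = \<sigma> id_blinfun (x *\<^sub>R id_blinfun))"

text \<open>The transpose of \<open>f\<close>, extended to \<open>0\<close> by continuity.\<close>

definition transpose_fun :: "(real \<Rightarrow> real) \<Rightarrow> real \<Rightarrow> real" where
  "transpose_fun f x =
     (if x > 0 then x * f (1 / x) else Lim (at_right 0) (\<lambda>y. y * f (1 / y)))"

section \<open>Weighted harmonic means and associated measures\<close>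

definition harmonic_formula ::
    "real \<Rightarrow> ('a::chilbert_space \<Rightarrow>\<^sub>L 'a) \<Rightarrow> ('a \<Rightarrow>\<^sub>L 'a) \<Rightarrow> ('a \<Rightarrow>\<^sub>L 'a)" where
  "harmonic_formula t A B = inverse_op ((1 - t) *\<^sub>R inverse_op A + t *\<^sub>R inverse_op B)"

definition weighted_harmonic_mean ::
    "real \<Rightarrow> ('a::chilbert_space \<Rightarrow>\<^sub>L 'a) \<Rightarrow> ('a \<Rightarrow>\<^sub>L 'a) \<Rightarrow> ('a \<Rightarrow>\<^sub>L 'a)" where
  "weighted_harmonic_mean t A B =
     (if strictly_positive_op A \<and> strictly_positive_op B then harmonic_formula t A B
      else (THE T :: 'a \<Rightarrow>\<^sub>L 'a. \<forall>x. ((\<lambda>\<epsilon>. harmonic_formula t (A + \<epsilon> *\<^sub>R id_blinfun) (B + \<epsilon> *\<^sub>R id_blinfun) x)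
                         \<longlongrightarrow> T x) (at_right 0)))"

text \<open>The operator-valued integral is understood in the weak sense.\<close>

definition has_weak_integral ::
    "real measure \<Rightarrow> (real \<Rightarrow> ('a::chilbert_space \<Rightarrow>\<^sub>L 'a)) \<Rightarrow> ('a \<Rightarrow>\<^sub>L 'a) \<Rightarrow> bool" where
  "has_weak_integral \<mu> F T \<longleftrightarrow>
     (\<forall>x y. integrable \<mu> (\<lambda>t. cinner (F t x) y) \<and>
            (LINT t|\<mu>. cinner (F t x) y) = cinner (T x) y)"

abbreviation borel01 :: "real measure" where
  "borel01 \<equiv> restrict_space borel {0..1}"

definition associated_measure ::
    "(('a::chilbert_space \<Rightarrow>\<^sub>L 'a) \<Rightarrow> ('a \<Rightarrow>\<^sub>L 'a) \<Rightarrow> ('a \<Rightarrow>\<^sub>L 'a)) \<Rightarrow> real measure \<Rightarrow> bool" where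
  "associated_measure \<sigma> \<mu> \<longleftrightarrow> finite_measure \<mu> \<and> sets \<mu> = sets borel01 \<and>
     (\<forall>A B. positive_op A \<longrightarrow> positive_op B \<longrightarrow>
        has_weak_integral \<mu> (\<lambda>t. weighted_harmonic_mean t A B) (\<sigma> A B))"

end

theory Submission
  imports Defs "HOL-Computational_Algebra.Fundamental_Theorem_Algebra"
begin

text \<open>
  On operators \<open>B \<sigma> I\<close> is the functional calculus \<open>g(B)\<close> of the transpose
  \<open>g(x) = \<integral> h\<^sub>t(x) d\<mu>(t)\<close> of \<open>f\<close>, where \<open>h\<^sub>t(x) = x / (1 - t + t x)\<close> and \<open>h\<^sub>1 = 1\<close>. Each \<open>h\<^sub>t\<close> with
  \<open>t < 1\<close> is strictly increasing, so \<open>g\<close> is strictly increasing unless \<open>\<mu>\<close> is concentrated at \<open>1\<close>, in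
  which case \<open>\<sigma>\<close> is a multiple of the right-trivial mean. If \<open>g\<close> is strictly increasing, polynomials
  approximating its inverse recover \<open>B\<close> from \<open>g(B)\<close>. A general \<open>A > 0\<close> on the right is reduced to \<open>I\<close>
  by the congruence \<open>S B S \<sigma> S\<^sup>2 = S (B \<sigma> I) S\<close> with \<open>S\<close> the square root of \<open>A\<close>.

  The functional calculus rests on \<open>\<parallel>p(B)\<parallel> \<le> sup |p|\<close> over \<open>[0, M]\<close> for real polynomials \<open>p\<close> and
  \<open>0 \<le> B \<le> M\<close>: otherwise \<open>\<parallel>p(B)\<parallel>\<^sup>2 - p\<^sup>2\<close> has no root in \<open>[0, M]\<close>, so factoring it into real linear and
  quadratic polynomials shows that \<open>\<parallel>p(B)\<parallel>\<^sup>2 - p(B)\<^sup>2\<close> is bounded below, which is impossible for the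
  self-adjoint operator \<open>p(B)\<close>.
\<close>

section \<open>Real inner product and self-adjoint operators\<close>

text \<open>Operators are only real-linear by type, so estimates run with this real inner product.
  For complex-linear operators the imaginary part of \<open>cinner\<close> is recovered from it by
  \<open>Im_cinner\<close>.\<close>

definition rinner :: "'a::chilbert_space \<Rightarrow> 'a \<Rightarrow> real" where
  "rinner x y = Re (cinner x y)"

lemma rinner_commute: "rinner x y = rinner y x"
  unfolding rinner_def by (metis cinner_commute cnj.simps(1))

lemma rinner_self: "rinner x x = (norm x)\<^sup>2"
  by (simp add: rinner_def cinner_self)

lemma rinner_add_left: "rinner (x + y) z = rinner x z + rinner y z"
  by (simp add: rinner_def cinner_add_left)

lemma rinner_add_right: "rinner z (x + y) = rinner z x + rinner z y"
  by (metis rinner_add_left rinner_commute)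

lemma rinner_scaleR_left: "rinner (r *\<^sub>R x) y = r * rinner x y"
  by (simp add: rinner_def scaleR_eq_scaleC cinner_scaleC_left)

lemma rinner_scaleR_right: "rinner x (r *\<^sub>R y) = r * rinner x y"
  by (metis rinner_scaleR_left rinner_commute)

lemma rinner_minus_left: "rinner (- x) y = - rinner x y"
  using rinner_scaleR_left[of "-1" x y] by simp

lemma rinner_diff_left: "rinner (x - y) z = rinner x z - rinner y z"
  using rinner_add_left[of x "-y" z] by (simp add: rinner_minus_left)

lemma rinner_diff_right: "rinner z (x - y) = rinner z x - rinner z y"
  by (metis rinner_diff_left rinner_commute)

text \<open>The square of the norm of \<open>norm y *\<^sub>R x - norm x *\<^sub>R y\<close> is
  nonnegative, and it equals a positive factor times the gap in the inequality. Zero vectors are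
  split off because there the factor vanishes.\<close>

lemma rinner_Cauchy_Schwarz: "\<bar>rinner x y\<bar> \<le> norm x * norm y"
proof -
  have le: "rinner x y \<le> norm x * norm y" for x y :: 'a
  proof (cases "x = 0 \<or> y = 0")
    case True
    then show ?thesis
      using rinner_scaleR_left[of 0 x y] rinner_scaleR_right[of x 0 y] by auto
  next
    case False
    let ?z = "norm y *\<^sub>R x - norm x *\<^sub>R y"
    have "0 \<le> rinner ?z ?z" by (simp add: rinner_self)
    also have "\<dots> = 2 * (norm x * norm y) * (norm x * norm y - rinner x y)"
      unfolding rinner_diff_left rinner_diff_right rinner_scaleR_left rinner_scaleR_right
        rinner_commute[of y x] by (simp add: rinner_self algebra_simps power2_eq_square)
    finally show ?thesis
      using False by (smt (verit) mult_pos_pos zero_le_mult_iff zero_less_norm_iff)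
  qed
  show ?thesis
    using le[of x y] le[of "-x" y] by (simp add: rinner_minus_left abs_le_iff)
qed

lemma bounded_bilinear_rinner: "bounded_bilinear (rinner :: 'a::chilbert_space \<Rightarrow> 'a \<Rightarrow> real)"
  by standard (auto simp: rinner_add_left rinner_add_right rinner_scaleR_left rinner_scaleR_right
      intro!: exI[of _ 1] rinner_Cauchy_Schwarz)

interpretation rinner: bounded_bilinear "rinner :: 'a::chilbert_space \<Rightarrow> 'a \<Rightarrow> real"
  by (rule bounded_bilinear_rinner)

lemma eq_if_rinner_eq:
  assumes "\<And>y. rinner u y = rinner v y"
  shows "u = v"
  using assms[of "u - v"] rinner_self[of "u - v"] by (simp add: rinner_diff_left)

lemma Im_cinner: "Im (cinner x y) = - rinner (\<i> *\<^sub>C x) y"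
  by (simp add: rinner_def cinner_scaleC_left)

text \<open>Symmetry of the real form is enough: together with complex linearity it gives the
  symmetry of \<open>cinner\<close>, see \<open>cinner_selfadjoint\<close>.\<close>

definition selfadjoint :: "('a::chilbert_space \<Rightarrow>\<^sub>L 'a) \<Rightarrow> bool" where
  "selfadjoint T \<longleftrightarrow> (\<forall>x y. rinner (T x) y = rinner x (T y))"

lemma selfadjointD: "selfadjoint T \<Longrightarrow> rinner (T x) y = rinner x (T y)"
  by (simp add: selfadjoint_def)

lemma cinner_add_right: "cinner z (x + y) = cinner z x + cinner z y"
  by (metis cinner_add_left cinner_commute complex_cnj_add)

lemma cinner_selfadjoint:
  assumes "complex_linear_op T" "selfadjoint T"
  shows "cinner (T x) y = cinner x (T y)"
proof (rule complex_eqI)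
  show "Re (cinner (T x) y) = Re (cinner x (T y))"
    using selfadjointD[OF assms(2)] by (simp add: rinner_def)
  show "Im (cinner (T x) y) = Im (cinner x (T y))"
    unfolding Im_cinner using assms by (metis complex_linear_op_def selfadjointD)
qed

text \<open>Polarisation: reality of the form at \<open>x + y\<close>, \<open>x\<close> and
  \<open>y\<close> gives the symmetry of the imaginary parts, and replacing \<open>x\<close> by
  \<open>\<i> *\<^sub>C x\<close> turns these into real parts. Conversely, self-adjointness makes
  \<open>cinner (T x) x\<close> equal to its own conjugate.\<close>

lemma positive_op_iff:
  "positive_op T \<longleftrightarrow> complex_linear_op T \<and> selfadjoint T \<and> (\<forall>x. 0 \<le> rinner (T x) x)"
proof
  assume T: "positive_op T"
  then have lin: "complex_linear_op T" and Im0: "Im (cinner (T x) x) = 0"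
    and pos: "0 \<le> rinner (T x) x" for x
    by (auto simp: positive_op_def rinner_def)
  have Im_eq: "Im (cinner (T x) y) = Im (cinner x (T y))" for x y
  proof -
    have "Im (cinner (T x) y) = - Im (cinner (T y) x)"
      using Im0[of "x + y"] Im0[of x] Im0[of y]
      by (simp add: blinfun.add_right cinner_add_left cinner_add_right)
    also have "\<dots> = Im (cinner x (T y))"
      by (subst (2) cinner_commute) simp
    finally show ?thesis .
  qed
  have "rinner (T x) y = rinner x (T y)" for x y
    using Im_eq[of "\<i> *\<^sub>C x" y] lin
    by (simp add: complex_linear_op_def cinner_scaleC_left rinner_def)
  with lin pos show "complex_linear_op T \<and> selfadjoint T \<and> (\<forall>x. 0 \<le> rinner (T x) x)"
    by (simp add: selfadjoint_def)
next
  assume T: "complex_linear_op T \<and> selfadjoint T \<and> (\<forall>x. 0 \<le> rinner (T x) x)"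
  have "Im (cinner (T x) x) = 0" for x
  proof -
    have "cinner (T x) x = cnj (cinner (T x) x)"
      using T cinner_selfadjoint[of T x x] cinner_commute[of x "T x"] by simp
    then show ?thesis by (metis cnj.simps(2) equation_minus_iff neg_equal_zero)
  qed
  with T show "positive_op T" by (simp add: positive_op_def rinner_def)
qed

lemma positive_opD:
  assumes "positive_op T"
  shows "complex_linear_op T" "selfadjoint T" "0 \<le> rinner (T x) x"
  using assms by (auto simp: positive_op_iff)

section \<open>Complex scalars; closure properties of complex-linear and self-adjoint
  operators\<close>

lemma norm_scaleC: "norm (c *\<^sub>C (x::'a::chilbert_space)) = cmod c * norm x"
proof -
  have "complex_of_real ((norm (c *\<^sub>C x))\<^sup>2) = c * cnj c * complex_of_real ((norm x)\<^sup>2)"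
    by (metis cinner_scaleC_left cinner_commute cinner_self complex_cnj_mult mult.assoc)
  also have "\<dots> = complex_of_real ((cmod c * norm x)\<^sup>2)"
    by (simp add: complex_norm_square[symmetric] power_mult_distrib)
  finally have "(norm (c *\<^sub>C x))\<^sup>2 = (cmod c * norm x)\<^sup>2"
    using of_real_eq_iff by blast
  then show ?thesis by (simp add: power2_eq_iff_nonneg)
qed

lemma bounded_linear_scaleC: "bounded_linear (\<lambda>x::'a::chilbert_space. c *\<^sub>C x)"
proof (rule bounded_linear_intro)
  fix x y :: 'a and r :: real
  show "c *\<^sub>C (x + y) = c *\<^sub>C x + c *\<^sub>C y" by (rule scaleC_add_right)
  show "c *\<^sub>C r *\<^sub>R x = r *\<^sub>R c *\<^sub>C x"
    by (simp add: scaleR_eq_scaleC scaleC_scaleC mult.commute)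
  show "norm (c *\<^sub>C x) \<le> norm x * cmod c" by (simp add: norm_scaleC)
qed

lemmas scaleR_scaleC_commute = linear_scale[OF bounded_linear.linear[OF bounded_linear_scaleC]]

lemma complex_linear_op_intros [intro]:
  "complex_linear_op id_blinfun" "complex_linear_op 0"
  "complex_linear_op A \<Longrightarrow> complex_linear_op B \<Longrightarrow> complex_linear_op (A + B)"
  "complex_linear_op A \<Longrightarrow> complex_linear_op B \<Longrightarrow> complex_linear_op (A o\<^sub>L B)"
  "complex_linear_op A \<Longrightarrow> complex_linear_op (r *\<^sub>R A)"
  using linear_0[OF bounded_linear.linear[OF bounded_linear_scaleC]]
  by (auto simp: complex_linear_op_def blinfun.bilinear_simps scaleC_add_right
      scaleR_scaleC_commute)

lemma selfadjoint_intros [intro]: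
  "selfadjoint id_blinfun" "selfadjoint 0"
  "selfadjoint A \<Longrightarrow> selfadjoint B \<Longrightarrow> selfadjoint (A + B)"
  "selfadjoint A \<Longrightarrow> selfadjoint (r *\<^sub>R A)"
  by (auto simp: selfadjoint_def blinfun.bilinear_simps rinner.add_left rinner.add_right
      rinner.scaleR_left rinner.scaleR_right)

lemma complex_linear_op_limit:
  fixes X :: "nat \<Rightarrow> 'a::chilbert_space \<Rightarrow>\<^sub>L 'a"
  assumes "X \<longlonglongrightarrow> T" "\<And>n. complex_linear_op (X n)"
  shows "complex_linear_op T"
  unfolding complex_linear_op_def
proof (intro allI)
  fix c :: complex and x :: 'a
  have "(\<lambda>n. X n (c *\<^sub>C x)) \<longlonglongrightarrow> T (c *\<^sub>C x)"
    by (intro tendsto_intros assms)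
  moreover have "(\<lambda>n. c *\<^sub>C X n x) \<longlonglongrightarrow> c *\<^sub>C T x"
    by (intro bounded_linear.tendsto[OF bounded_linear_scaleC] tendsto_intros assms)
  moreover have "(\<lambda>n. X n (c *\<^sub>C x)) = (\<lambda>n. c *\<^sub>C X n x)"
    using assms(2) by (auto simp: complex_linear_op_def)
  ultimately show "T (c *\<^sub>C x) = c *\<^sub>C T x"
    using LIMSEQ_unique by metis
qed

lemma selfadjoint_limit:
  fixes X :: "nat \<Rightarrow> 'a::chilbert_space \<Rightarrow>\<^sub>L 'a"
  assumes "X \<longlonglongrightarrow> T" "\<And>n. selfadjoint (X n)"
  shows "selfadjoint T"
  unfolding selfadjoint_def
proof (intro allI)
  fix x y :: 'a
  have "(\<lambda>n. rinner (X n x) y) \<longlonglongrightarrow> rinner (T x) y" "(\<lambda>n. rinner x (X n y)) \<longlonglongrightarrow> rinner x (T y)"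
    by (intro rinner.tendsto tendsto_intros assms)+
  then show "rinner (T x) y = rinner x (T y)"
    using assms(2) LIMSEQ_unique by (fastforce simp: selfadjoint_def)
qed

section \<open>Inverses of operators\<close>

lemma complex_linear_op_inverse:
  assumes "complex_linear_op T" "S o\<^sub>L T = id_blinfun" "T o\<^sub>L S = id_blinfun"
  shows "complex_linear_op S"
  unfolding complex_linear_op_def
proof (intro allI)
  fix c x
  have id: "S (T y) = y" "T (S y) = y" for y
    using assms(2,3) by (metis blinfun_apply_blinfun_compose blinfun_apply_id_blinfun id_apply)+
  have "S (c *\<^sub>C x) = S (T (c *\<^sub>C S x))"
    using assms(1) by (simp add: complex_linear_op_def id)
  then show "S (c *\<^sub>C x) = c *\<^sub>C S x" by (simp add: id)
qed

lemma selfadjoint_inverse: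
  assumes "selfadjoint T" "S o\<^sub>L T = id_blinfun" "T o\<^sub>L S = id_blinfun"
  shows "selfadjoint S"
  unfolding selfadjoint_def
proof (intro allI)
  fix x y
  have id: "T (S y) = y" for y
    using assms(3) by (metis blinfun_apply_blinfun_compose blinfun_apply_id_blinfun id_apply)
  show "rinner (S x) y = rinner x (S y)"
    using selfadjointD[OF assms(1), of "S x" "S y"] by (simp add: id)
qed

lemma inverse_op_eqI:
  assumes "S o\<^sub>L T = id_blinfun" "T o\<^sub>L S = id_blinfun"
  shows "inverse_op T = S"
  unfolding inverse_op_def
proof (rule the_equality)
  fix R assume "R o\<^sub>L T = id_blinfun \<and> T o\<^sub>L R = id_blinfun"
  then have "R o\<^sub>L T o\<^sub>L S = S"
    by (auto intro: blinfun_eqI)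
  moreover have "R o\<^sub>L T o\<^sub>L S = R o\<^sub>L (T o\<^sub>L S)"
    by (auto intro: blinfun_eqI)
  ultimately show "R = S"
    using assms(2) by (auto intro: blinfun_eqI)
qed (use assms in auto)

lemma inverse_op:
  assumes "invertible_op T"
  shows "inverse_op T o\<^sub>L T = id_blinfun" "T o\<^sub>L inverse_op T = id_blinfun"
  using assms inverse_op_eqI unfolding invertible_op_def by metis+

section \<open>The norm bound for polynomials of a positive operator\<close>

interpretation blinfun_compose: bounded_bilinear
  "(o\<^sub>L) :: ('b::real_normed_vector \<Rightarrow>\<^sub>L 'c::real_normed_vector) \<Rightarrow>
     ('a::real_normed_vector \<Rightarrow>\<^sub>L 'b) \<Rightarrow> ('a \<Rightarrow>\<^sub>L 'c)"
  by (rule bounded_bilinear_blinfun_compose)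

section \<open>Polynomials in one operator\<close>

text \<open>Coefficients beyond the degree vanish. This slack lets \<open>poly_op_pCons\<close>
  avoid a case distinction on whether the degree really grows.\<close>

lemma poly_op_eq_sum:
  assumes "degree p \<le> n"
  shows "poly_op p A = (\<Sum>i\<le>n. coeff p i *\<^sub>R (((o\<^sub>L) A) ^^ i) id_blinfun)"
  unfolding poly_op_def using assms
  by (intro sum.mono_neutral_left) (auto simp: coeff_eq_0)

lemma poly_op_0 [simp]: "poly_op 0 A = 0"
  by (simp add: poly_op_def)

lemma poly_op_pCons: "poly_op (pCons a p) A = a *\<^sub>R id_blinfun + (A o\<^sub>L poly_op p A)"
proof -
  have "poly_op (pCons a p) A
      = (\<Sum>i\<le>Suc (degree p). coeff (pCons a p) i *\<^sub>R (((o\<^sub>L) A) ^^ i) id_blinfun)"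
    by (rule poly_op_eq_sum) (rule degree_pCons_le)
  also have "\<dots> = a *\<^sub>R id_blinfun + (A o\<^sub>L poly_op p A)"
    by (simp add: sum.atMost_Suc_shift poly_op_def blinfun_compose.sum_right
        blinfun_compose.scaleR_right del: sum.atMost_Suc)
  finally show ?thesis .
qed

lemma poly_op_add: "poly_op (p + q) A = poly_op p A + poly_op q A"
proof (induction p q rule: poly_induct2)
  case (pCons a p b q)
  then show ?case
    by (simp add: poly_op_pCons blinfun_compose.add_right scaleR_add_left)
qed simp

lemma poly_op_smult: "poly_op (smult c p) A = c *\<^sub>R poly_op p A"
proof (induction p)
  case (pCons a p)
  then show ?case
    by (simp add: poly_op_pCons blinfun_compose.scaleR_right scaleR_add_right)
qed simp

lemma poly_op_diff: "poly_op (p - q) A = poly_op p A - poly_op q A"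
  using poly_op_add[of p "- q" A] poly_op_smult[of "- 1" q A] by simp

lemma poly_op_1 [simp]: "poly_op 1 A = id_blinfun"
  by (simp add: one_pCons poly_op_pCons)

lemma poly_op_mult: "poly_op (p * q) A = poly_op p A o\<^sub>L poly_op q A"
proof (induction p)
  case (pCons a p)
  then show ?case
    by (intro blinfun_eqI)
      (simp add: poly_op_pCons poly_op_add poly_op_smult blinfun.bilinear_simps)
qed simp

lemma poly_op_commute: "A o\<^sub>L poly_op p A = poly_op p A o\<^sub>L A"
proof -
  \<comment> \<open>With \<open>A\<close> itself written as a polynomial in \<open>A\<close>,
    commutation follows from commutativity of polynomial multiplication.\<close>
  have "poly_op [:0, 1:] A = A"
    by (auto intro: blinfun_eqI simp: poly_op_pCons blinfun.bilinear_simps)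
  then show ?thesis
    by (metis poly_op_mult mult.commute)
qed

text \<open>A product of self-adjoint operators is self-adjoint when the factors commute, as
  \<open>A\<close> and \<open>poly_op p A\<close> do.\<close>

lemma selfadjoint_poly_op:
  assumes "selfadjoint A"
  shows "selfadjoint (poly_op p A)"
proof (induction p)
  case (pCons a p)
  have "rinner (A (poly_op p A x)) y = rinner x (A (poly_op p A y))" for x y
  proof -
    have "A (poly_op p A y) = poly_op p A (A y)"
      using poly_op_commute[of A p] by (metis blinfun_apply_blinfun_compose)
    then show ?thesis
      using selfadjointD[OF assms] selfadjointD[OF pCons.IH] by metis
  qed
  then show ?case
    unfolding poly_op_pCons by (intro selfadjoint_intros) (simp add: selfadjoint_def)
qed auto

lemma complex_linear_op_poly_op:
  assumes "complex_linear_op A"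
  shows "complex_linear_op (poly_op p A)"
  by (induction p) (use assms in \<open>auto simp: poly_op_pCons\<close>)

section \<open>Factoring real polynomials\<close>

lemma poly_of_real_add:
  "poly (map_poly complex_of_real (p + q)) z
    = poly (map_poly complex_of_real p) z + poly (map_poly complex_of_real q) z"
  by (induction p q rule: poly_induct2) (simp_all add: map_poly_pCons algebra_simps)

lemma poly_of_real_smult:
  "poly (map_poly complex_of_real (smult c p)) z = c * poly (map_poly complex_of_real p) z"
  by (induction p) (simp_all add: map_poly_pCons algebra_simps)

lemma poly_of_real_mult:
  "poly (map_poly complex_of_real (p * q)) z
    = poly (map_poly complex_of_real p) z * poly (map_poly complex_of_real q) z"
  by (induction p)
    (simp_all add: map_poly_pCons poly_of_real_add poly_of_real_smult algebra_simps)

text \<open>A complex root \<open>z\<close> exists. If it is real, it splits off a linear factor.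
  Otherwise the remainder of \<open>p\<close> modulo the real quadratic with roots \<open>z\<close>
  and its conjugate has degree below 2, real coefficients and a non-real root, so it is
  zero.\<close>

lemma real_poly_factor:
  fixes p :: "real poly"
  assumes "degree p > 0"
  obtains (linear) r q where "p = [:- r, 1:] * q"
  | (quadratic) a b q where "b \<noteq> 0" "p = [:a\<^sup>2 + b\<^sup>2, - 2 * a, 1:] * q"
proof -
  let ?P = "\<lambda>p. poly (map_poly complex_of_real p)"
  have "degree (map_poly complex_of_real p) = degree p"
    by (rule degree_map_poly) simp
  then have "\<not> constant (?P p)"
    using assms by (simp add: constant_degree)
  then obtain z where z: "?P p z = 0"
    using fundamental_theorem_of_algebra by blast
  show ?thesis
  proof (cases "Im z = 0")
    case True
    then have "complex_of_real (Re z) = z" by (simp add: complex_eq_iff)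
    then have "?P p (complex_of_real (Re z)) = 0" using z by simp
    moreover have "?P p (complex_of_real x) = complex_of_real (poly p x)" for x
      by (induction p) (simp_all add: map_poly_pCons)
    ultimately have "poly p (Re z) = 0" by simp
    then show ?thesis using linear by (auto simp: poly_eq_0_iff_dvd dvd_def)
  next
    case False
    let ?s = "[:(Re z)\<^sup>2 + (Im z)\<^sup>2, - 2 * Re z, 1:]"
    define r where "r = p mod ?s"
    have "?s \<noteq> 0" "degree ?s = 2" by simp_all
    then have "degree r < 2 \<or> r = 0"
      unfolding r_def by (metis degree_mod_less)
    then have r: "r = [:coeff r 0, coeff r 1:]"
      by (intro poly_eqI) (auto simp: coeff_pCons split: nat.split intro!: coeff_eq_0)
    have "?P ?s z = 0"
      by (simp add: map_poly_pCons complex_eq_iff power2_eq_square algebra_simps)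
    moreover have "p = ?s * (p div ?s) + r"
      unfolding r_def by (simp only: mult_div_mod_eq)
    ultimately have "?P r z = 0"
      using z by (metis add_0 mult_zero_left poly_of_real_add poly_of_real_mult)
    then have "complex_of_real (coeff r 0) + z * complex_of_real (coeff r 1) = 0"
      by (subst (asm) r) (simp add: map_poly_pCons)
    then have "coeff r 1 = 0" "coeff r 0 = 0"
      using False by (auto simp: complex_eq_iff)
    then have "r = 0" using r by simp
    then have "p = ?s * (p div ?s)" using \<open>p = ?s * (p div ?s) + r\<close> by simp
    then show ?thesis using quadratic[OF False] by blast
  qed
qed

section \<open>Operators bounded below\<close>

lemma rinner_le_norm_mult:
  fixes A :: "'a::chilbert_space \<Rightarrow>\<^sub>L 'a"
  assumes "norm A \<le> M"
  shows "rinner (A x) x \<le> M * (norm x)\<^sup>2"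
proof -
  have "rinner (A x) x \<le> norm (A x) * norm x"
    using rinner_Cauchy_Schwarz[of "A x" x] by simp
  also have "\<dots> \<le> (M * norm x) * norm x"
    using order_trans[OF norm_blinfun[of A x] mult_right_mono[OF assms norm_ge_zero]]
    by (intro mult_right_mono) auto
  finally show ?thesis by (simp add: power2_eq_square mult.assoc)
qed

text \<open>A substitute for invertibility that passes to compositions and asks for no inverse to be
  constructed.\<close>

definition bounded_below :: "('a::chilbert_space \<Rightarrow>\<^sub>L 'a) \<Rightarrow> bool" where
  "bounded_below T \<longleftrightarrow> (\<exists>c>0. \<forall>x. c * norm x \<le> norm (T x))"

lemma bounded_below_compose:
  assumes "bounded_below S" "bounded_below T"
  shows "bounded_below (S o\<^sub>L T)"
proof -
  obtain c d where "c > 0" "d > 0" and c: "\<And>x. c * norm x \<le> norm (S x)"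
    and d: "\<And>x. d * norm x \<le> norm (T x)"
    using assms unfolding bounded_below_def by metis
  have "(c * d) * norm x \<le> norm ((S o\<^sub>L T) x)" for x
    using order_trans[OF mult_left_mono[OF d[of x], of c] c[of "T x"]] \<open>c > 0\<close>
    by (simp add: mult.assoc)
  then show ?thesis
    unfolding bounded_below_def using \<open>c > 0\<close> \<open>d > 0\<close> by (intro exI[of _ "c * d"]) simp
qed

text \<open>Cauchy-Schwarz bounds the form by \<open>norm (T x) * norm x\<close>, and one factor
  \<open>norm x\<close> cancels. The absolute value covers negative definite forms as well.\<close>

lemma bounded_below_if_coercive:
  fixes T :: "'a::chilbert_space \<Rightarrow>\<^sub>L 'a"
  assumes "c > 0" "\<And>x. c * (norm x)\<^sup>2 \<le> \<bar>rinner (T x) x\<bar>"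
  shows "bounded_below T"
proof -
  have "c * norm x \<le> norm (T x)" for x
  proof (cases "x = 0")
    case False
    have "(c * norm x) * norm x \<le> norm (T x) * norm x"
      using assms(2)[of x] rinner_Cauchy_Schwarz[of "T x" x] by (simp add: power2_eq_square mult.assoc)
    then show ?thesis using False by simp
  qed simp
  then show ?thesis using assms(1) unfolding bounded_below_def by blast
qed

text \<open>Induction on the degree, splitting off one real factor at a time. A linear factor has
  its root outside \<open>{0..M}\<close> and so gives a form that is positive definite (root below
  0) or negative definite (root above \<open>M\<close>). A quadratic factor is
  \<open>(A - a)\<^sup>2 + b\<^sup>2\<close>, whose form is at least
  \<open>b\<^sup>2 * (norm x)\<^sup>2\<close>.\<close>

lemma bounded_below_poly_op:
  fixes A :: "'a::chilbert_space \<Rightarrow>\<^sub>L 'a"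
  assumes "positive_op A" "norm A \<le> M" "\<And>x. x \<in> {0..M} \<Longrightarrow> poly p x \<noteq> 0"
  shows "bounded_below (poly_op p A)"
  using assms(3)
proof (induction "degree p" arbitrary: p rule: less_induct)
  case less
  have "0 \<le> M" using assms(2) norm_ge_zero order_trans by blast
  then have "p \<noteq> 0" using less.prems[of 0] by auto
  note pos = positive_opD[OF assms(1)]
  show ?case
  proof (cases "degree p = 0")
    case True
    then obtain c where p: "p = [:c:]" by (metis degree_eq_zeroE)
    then have "poly_op p A x = c *\<^sub>R x" for x
      by (simp add: poly_op_pCons blinfun.bilinear_simps)
    moreover have "c \<noteq> 0" using p \<open>p \<noteq> 0\<close> by auto
    ultimately show ?thesis
      unfolding bounded_below_def by (intro exI[of _ "\<bar>c\<bar>"]) auto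
  next
    case False
    then have "degree p > 0" by simp
    then obtain s q where p: "p = s * q" and s: "degree s > 0" "bounded_below (poly_op s A)"
    proof (cases rule: real_poly_factor)
      case (linear r q)
      have "poly p r = 0" using linear by simp
      then have r: "r < 0 \<or> r > M" using less.prems[of r] by force
      have eq: "rinner (poly_op [:- r, 1:] A x) x = rinner (A x) x - r * (norm x)\<^sup>2" for x
        by (simp add: poly_op_pCons blinfun.bilinear_simps rinner.diff_left rinner.scaleR_left
            rinner_self)
      have "bounded_below (poly_op [:- r, 1:] A)"
      proof (cases "r < 0")
        case True
        then show ?thesis
          by (intro bounded_below_if_coercive[of "- r"] order_trans[OF _ abs_ge_self])
            (auto simp: eq pos(3))
      next
        case False
        have "(r - M) * (norm x)\<^sup>2 \<le> \<bar>rinner (poly_op [:- r, 1:] A x) x\<bar>" for x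
          using rinner_le_norm_mult[OF assms(2), of x] eq[of x] by (simp add: algebra_simps)
        then show ?thesis
          using False r by (intro bounded_below_if_coercive[of "r - M"]) auto
      qed
      then show ?thesis by (intro that[OF linear]) auto
    next
      case (quadratic a b q)
      let ?s = "[:a\<^sup>2 + b\<^sup>2, - 2 * a, 1:]"
      have "b\<^sup>2 * (norm x)\<^sup>2 \<le> rinner (poly_op ?s A x) x" for x
      proof -
        have "rinner (poly_op ?s A x) x = (norm (A x - a *\<^sub>R x))\<^sup>2 + b\<^sup>2 * (norm x)\<^sup>2"
          unfolding rinner_self[symmetric]
          using selfadjointD[OF pos(2), of "A x" x]
          by (simp add: poly_op_pCons blinfun.bilinear_simps rinner.diff_left rinner.diff_right
              rinner.scaleR_left rinner.scaleR_right rinner.add_left rinner_commute[of x "A x"]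
              power2_eq_square algebra_simps)
        then show ?thesis by simp
      qed
      then have "bounded_below (poly_op ?s A)"
        using quadratic(1)
        by (intro bounded_below_if_coercive[of "b\<^sup>2"] order_trans[OF _ abs_ge_self]) auto
      then show ?thesis by (intro that[OF quadratic(2)]) auto
    qed
    have "q \<noteq> 0" "s \<noteq> 0" using p \<open>p \<noteq> 0\<close> by auto
    then have "degree q < degree p" using p s(1) by (simp add: degree_mult_eq)
    moreover have "poly q x \<noteq> 0" if "x \<in> {0..M}" for x
      using less.prems[OF that] p by auto
    ultimately have "bounded_below (poly_op q A)" by (rule less.hyps)
    then show ?thesis
      unfolding p poly_op_mult by (intro bounded_below_compose s(2))
  qed
qed

text \<open>Vectors that nearly attain the norm \<open>n\<close> of \<open>T\<close> are nearly
  eigenvectors of \<open>T o\<^sub>L T\<close> for the value \<open>n\<^sup>2\<close>, which the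
  lower bound \<open>c\<close> forbids. Quantitatively, expanding the norm of
  \<open>n\<^sup>2 *\<^sub>R x - T (T x)\<close> improves the bound on
  \<open>(norm (T x))\<^sup>2\<close> by the term
  \<open>c\<^sup>2 / n\<^sup>2 * (norm x)\<^sup>2\<close>.\<close>

lemma norm_less_if_bounded_below:
  assumes T: "selfadjoint T" and "bounded_below (n\<^sup>2 *\<^sub>R id_blinfun - (T o\<^sub>L T))" and n: "norm T \<le> n"
    and "n > 0"
  shows "norm T < n"
proof (rule ccontr)
  assume "\<not> norm T < n"
  with n have n: "n = norm T" by simp
  obtain c where "c > 0" and c: "\<And>x. c * norm x \<le> norm (n\<^sup>2 *\<^sub>R x - T (T x))"
    using assms(2) unfolding bounded_below_def by (auto simp: blinfun.bilinear_simps)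
  have bound: "c\<^sup>2 * (norm x)\<^sup>2 \<le> n\<^sup>2 * (n\<^sup>2 * (norm x)\<^sup>2 - (norm (T x))\<^sup>2)" for x
  proof -
    have "c\<^sup>2 * (norm x)\<^sup>2 \<le> (norm (n\<^sup>2 *\<^sub>R x - T (T x)))\<^sup>2"
      using c[of x] \<open>c > 0\<close> power_mono[of "c * norm x" _ 2] by (simp add: power_mult_distrib)
    also have "\<dots> = n\<^sup>2 * (n\<^sup>2 * (norm x)\<^sup>2) - 2 * n\<^sup>2 * (norm (T x))\<^sup>2 + (norm (T (T x)))\<^sup>2"
      unfolding rinner_self[symmetric]
      using selfadjointD[OF T, of "T x" x]
      by (simp add: rinner.diff_left rinner.diff_right rinner.scaleR_left rinner.scaleR_right
          rinner_commute[of x "T (T x)"] algebra_simps)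
    also have "(norm (T (T x)))\<^sup>2 \<le> (n * norm (T x))\<^sup>2"
      using norm_blinfun[of T "T x"] by (intro power_mono) (auto simp: n)
    finally show ?thesis by (simp add: power_mult_distrib algebra_simps)
  qed
  \<comment> \<open>The \<open>max 0\<close> spares a proof that the difference is
    nonnegative.\<close>
  let ?b = "sqrt (max 0 (n\<^sup>2 - c\<^sup>2 / n\<^sup>2))"
  have "norm T \<le> ?b"
  proof (rule norm_blinfun_bound)
    fix x
    have "(norm (T x))\<^sup>2 \<le> (n\<^sup>2 - c\<^sup>2 / n\<^sup>2) * (norm x)\<^sup>2"
      using bound[of x] \<open>n > 0\<close> by (simp add: field_simps)
    also have "\<dots> \<le> (?b * norm x)\<^sup>2"
      by (simp add: power_mult_distrib mult_right_mono)
    finally show "norm (T x) \<le> ?b * norm x"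
      by (rule power2_le_imp_le) simp
  qed simp
  also have "?b < n"
    using \<open>c > 0\<close> \<open>n > 0\<close> by (intro real_less_lsqrt) auto
  finally show False using n by simp
qed

lemma norm_poly_op_le:
  assumes "positive_op A" "norm A \<le> M" and le: "\<And>x. x \<in> {0..M} \<Longrightarrow> \<bar>poly p x\<bar> \<le> s"
  shows "norm (poly_op p A) \<le> s"
proof (rule ccontr)
  let ?T = "poly_op p A" and ?n = "norm (poly_op p A)"
  assume "\<not> ?n \<le> s"
  then have "s < ?n" by simp
  have "0 \<le> s"
    using le[of 0] assms(2) norm_ge_zero[of A] by (auto intro: order_trans[OF abs_ge_zero])
  with \<open>s < ?n\<close> have "?n > 0" by linarith
  \<comment> \<open>On the interval \<open>p\<close> is at most \<open>s\<close> in absolute value,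
    which lies strictly below \<open>?n\<close>, so the difference is positive there.\<close>
  have "poly ([:?n\<^sup>2:] - p * p) x \<noteq> 0" if "x \<in> {0..M}" for x
  proof -
    have "(poly p x)\<^sup>2 \<le> s\<^sup>2" using le[OF that] by (simp add: abs_le_square_iff[symmetric] \<open>0 \<le> s\<close>)
    also have "\<dots> < ?n\<^sup>2" using \<open>s < ?n\<close> \<open>0 \<le> s\<close> by (intro power_strict_mono) auto
    finally show ?thesis by (simp add: power2_eq_square)
  qed
  then have "bounded_below (poly_op ([:?n\<^sup>2:] - p * p) A)"
    by (intro bounded_below_poly_op[OF assms(1,2)])
  moreover have "poly_op ([:?n\<^sup>2:] - p * p) A = ?n\<^sup>2 *\<^sub>R id_blinfun - (?T o\<^sub>L ?T)"
    by (simp add: poly_op_diff poly_op_mult poly_op_pCons)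
  ultimately show False
    using norm_less_if_bounded_below[of ?T ?n] \<open>?n > 0\<close>
      selfadjoint_poly_op[OF positive_opD(2)[OF assms(1)]] by simp
qed

section \<open>Functional calculus on an interval\<close>

text \<open>A relation that asks for one approximating sequence only; \<open>fcalc_unique\<close>
  shows that its choice does not matter. The endpoint \<open>M\<close> is independent of
  \<open>norm A\<close>, so that two operators can share one interval in
  \<open>fcalc_inj\<close>.\<close>

definition fcalc :: "('a::chilbert_space \<Rightarrow>\<^sub>L 'a) \<Rightarrow> real \<Rightarrow> (real \<Rightarrow> real) \<Rightarrow> ('a \<Rightarrow>\<^sub>L 'a) \<Rightarrow> bool"
  where "fcalc A M \<phi> T \<longleftrightarrow> (\<exists>p. uniform_limit {0..M} (\<lambda>n. poly (p n)) \<phi> sequentially \<and>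
    (\<lambda>n. poly_op (p n) A) \<longlonglongrightarrow> T)"

lemma fcalc_poly: "fcalc A M (poly p) (poly_op p A)"
  unfolding fcalc_def by (intro exI[of _ "\<lambda>_. p"]) (auto intro: uniform_limit_const)

lemma fcalc_cong:
  assumes "fcalc A M \<phi> T" "\<And>x. x \<in> {0..M} \<Longrightarrow> \<phi> x = \<psi> x"
  shows "fcalc A M \<psi> T"
proof -
  have "uniform_limit {0..M} f \<phi> sequentially \<longleftrightarrow> uniform_limit {0..M} f \<psi> sequentially" for f
    using assms(2) by (intro uniform_limit_cong') auto
  then show ?thesis using assms(1) unfolding fcalc_def by simp
qed

lemma continuous_on_fcalc: "fcalc A M \<phi> T \<Longrightarrow> continuous_on {0..M} \<phi>"
  unfolding fcalc_def
  by (auto elim!: uniform_limit_theorem[rotated] intro!: always_eventually continuous_intros)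

lemma fcalc_add:
  assumes "fcalc A M \<phi> S" "fcalc A M \<psi> T"
  shows "fcalc A M (\<lambda>x. \<phi> x + \<psi> x) (S + T)"
proof -
  obtain p q where "uniform_limit {0..M} (\<lambda>n. poly (p n)) \<phi> sequentially"
      "(\<lambda>n. poly_op (p n) A) \<longlonglongrightarrow> S"
      "uniform_limit {0..M} (\<lambda>n. poly (q n)) \<psi> sequentially" "(\<lambda>n. poly_op (q n) A) \<longlonglongrightarrow> T"
    using assms unfolding fcalc_def by metis
  then show ?thesis
    unfolding fcalc_def
    by (intro exI[of _ "\<lambda>n. p n + q n"])
      (auto simp: poly_op_add poly_add[abs_def] intro!: uniform_limit_intros tendsto_intros)
qed

lemma fcalc_mult:
  assumes "fcalc A M \<phi> S" "fcalc A M \<psi> T"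
  shows "fcalc A M (\<lambda>x. \<phi> x * \<psi> x) (S o\<^sub>L T)"
proof -
  obtain p q where "uniform_limit {0..M} (\<lambda>n. poly (p n)) \<phi> sequentially"
      "(\<lambda>n. poly_op (p n) A) \<longlonglongrightarrow> S"
      "uniform_limit {0..M} (\<lambda>n. poly (q n)) \<psi> sequentially" "(\<lambda>n. poly_op (q n) A) \<longlonglongrightarrow> T"
    using assms unfolding fcalc_def by metis
  \<comment> \<open>Uniform limits multiply only if the limits are bounded; here they are continuous
    on a compact interval.\<close>
  moreover have "bounded (\<phi> ` {0..M})" "bounded (\<psi> ` {0..M})"
    using assms by (auto intro!: compact_imp_bounded compact_continuous_image continuous_on_fcalc)
  ultimately show ?thesis
    unfolding fcalc_def
    by (intro exI[of _ "\<lambda>n. p n * q n"])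
      (auto simp: poly_op_mult poly_mult[abs_def] intro!: uniform_lim_mult blinfun_compose.tendsto)
qed

lemma fcalc_diff:
  assumes "fcalc A M \<phi> S" "fcalc A M \<psi> T"
  shows "fcalc A M (\<lambda>x. \<phi> x - \<psi> x) (S - T)"
proof -
  obtain p q where "uniform_limit {0..M} (\<lambda>n. poly (p n)) \<phi> sequentially"
      "(\<lambda>n. poly_op (p n) A) \<longlonglongrightarrow> S"
      "uniform_limit {0..M} (\<lambda>n. poly (q n)) \<psi> sequentially" "(\<lambda>n. poly_op (q n) A) \<longlonglongrightarrow> T"
    using assms unfolding fcalc_def by metis
  then show ?thesis
    unfolding fcalc_def
    by (intro exI[of _ "\<lambda>n. p n - q n"])
      (auto simp: poly_op_diff poly_diff[abs_def] intro!: uniform_limit_intros tendsto_intros)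
qed

text \<open>Approximating polynomials are eventually bounded by \<open>s + e\<close> on the
  interval, so \<open>norm_poly_op_le\<close> applies to them and the bound passes to the
  limit.\<close>

lemma fcalc_norm_le:
  assumes A: "positive_op A" "norm A \<le> M" and "fcalc A M \<phi> T"
    and le: "\<And>x. x \<in> {0..M} \<Longrightarrow> \<bar>\<phi> x\<bar> \<le> s"
  shows "norm T \<le> s"
proof (rule field_le_epsilon)
  fix e :: real assume "e > 0"
  obtain p where p: "uniform_limit {0..M} (\<lambda>n. poly (p n)) \<phi> sequentially"
      "(\<lambda>n. poly_op (p n) A) \<longlonglongrightarrow> T"
    using assms unfolding fcalc_def by metis
  have "\<forall>\<^sub>F n in sequentially. \<forall>x\<in>{0..M}. dist (poly (p n) x) (\<phi> x) < e"
    using p(1) \<open>e > 0\<close> by (rule uniform_limitD)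
  then have "\<forall>\<^sub>F n in sequentially. norm (poly_op (p n) A) \<le> s + e"
  proof eventually_elim
    case (elim n)
    show ?case
    proof (rule norm_poly_op_le[OF A])
      fix x assume x: "x \<in> {0..M}"
      then have "\<bar>poly (p n) x - \<phi> x\<bar> < e" using elim by (simp add: dist_real_def)
      then show "\<bar>poly (p n) x\<bar> \<le> s + e" using le[OF x] by linarith
    qed
  qed
  then show "norm T \<le> s + e"
    using tendsto_norm[OF p(2)] by (intro tendsto_upperbound) auto
qed

lemma fcalc_unique:
  assumes "positive_op A" "norm A \<le> M" "fcalc A M \<phi> S" "fcalc A M \<phi> T"
  shows "S = T"
  using fcalc_norm_le[OF assms(1,2) fcalc_diff[OF assms(3,4)], of 0] by simp

section \<open>Existence of the calculus for continuous functions\<close>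

text \<open>Stone-Weierstrass with error \<open>1 / (n + 1)\<close> at stage \<open>n\<close>. A
  general compact set is allowed because \<open>fcalc_inj\<close> approximates on the image of an
  interval.\<close>

lemma uniform_poly_approx:
  fixes \<phi> :: "real \<Rightarrow> real"
  assumes "compact S" "continuous_on S \<phi>"
  obtains p where "uniform_limit S (\<lambda>n. poly (p n)) \<phi> sequentially"
proof -
  have "\<exists>p. \<forall>x\<in>S. \<bar>\<phi> x - poly p x\<bar> < e" if "e > 0" for e :: real
  proof -
    obtain g where g: "real_polynomial_function g" "\<And>x. x \<in> S \<Longrightarrow> \<bar>\<phi> x - g x\<bar> < e"
      using Stone_Weierstrass_real_polynomial_function[OF assms \<open>e > 0\<close>] by metis
    then obtain c n where "g = (\<lambda>x. \<Sum>i\<le>n. c i * x ^ i)"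
      unfolding real_polynomial_function_iff_sum by metis
    then have "g = poly (\<Sum>i\<le>n. monom (c i) i)"
      by (auto simp: poly_sum poly_monom)
    with g show ?thesis by metis
  qed
  then have "\<forall>n. \<exists>p. \<forall>x\<in>S. \<bar>\<phi> x - poly p x\<bar> < inverse (real (Suc n))" by simp
  then obtain p where p: "\<And>n x. x \<in> S \<Longrightarrow> \<bar>\<phi> x - poly (p n) x\<bar> < inverse (real (Suc n))"
    by metis
  have "uniform_limit S (\<lambda>n. poly (p n)) \<phi> sequentially"
  proof (rule uniform_limitI)
    fix e :: real assume "e > 0"
    then have "\<forall>\<^sub>F n in sequentially. inverse (real (Suc n)) < e"
      using order_tendstoD(2)[OF LIMSEQ_inverse_real_of_nat] by blast
    then show "\<forall>\<^sub>F n in sequentially. \<forall>x\<in>S. dist (poly (p n) x) (\<phi> x) < e"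
      by eventually_elim (use p in \<open>force simp: dist_real_def abs_minus_commute
          simp del: of_nat_Suc intro: less_trans\<close>)
  qed
  then show ?thesis using that by blast
qed

text \<open>The norm bound for polynomials turns a uniformly Cauchy sequence on the interval into a
  Cauchy sequence of operators.\<close>

lemma fcalc_exists:
  assumes A: "positive_op A" "norm A \<le> M" and "continuous_on {0..M} \<phi>"
  obtains T where "fcalc A M \<phi> T"
proof -
  obtain p where p: "uniform_limit {0..M} (\<lambda>n. poly (p n)) \<phi> sequentially"
    using uniform_poly_approx[OF compact_Icc assms(3)] by blast
  have "Cauchy (\<lambda>n. poly_op (p n) A)"
  proof (rule CauchyI)
    fix e :: real assume "e > 0"
    then have "\<forall>\<^sub>F n in sequentially. \<forall>x\<in>{0..M}. dist (poly (p n) x) (\<phi> x) < e / 4"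
      by (intro uniform_limitD[OF p]) simp
    then obtain N where N: "\<And>n x. n \<ge> N \<Longrightarrow> x \<in> {0..M} \<Longrightarrow> \<bar>poly (p n) x - \<phi> x\<bar> < e / 4"
      unfolding eventually_sequentially dist_real_def by blast
    have "norm (poly_op (p m) A - poly_op (p n) A) < e" if "m \<ge> N" "n \<ge> N" for m n
    proof -
      have "norm (poly_op (p m - p n) A) \<le> e / 2"
      proof (rule norm_poly_op_le[OF A])
        fix x assume x: "x \<in> {0..M}"
        show "\<bar>poly (p m - p n) x\<bar> \<le> e / 2"
          using N[OF that(1) x] N[OF that(2) x] unfolding poly_diff by argo
      qed
      then show ?thesis using \<open>e > 0\<close> by (simp add: poly_op_diff)
    qed
    then show "\<exists>N. \<forall>m\<ge>N. \<forall>n\<ge>N. norm (poly_op (p m) A - poly_op (p n) A) < e" by blast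
  qed
  then obtain T where "(\<lambda>n. poly_op (p n) A) \<longlonglongrightarrow> T"
    using Cauchy_convergent convergent_def by blast
  with p show ?thesis using that unfolding fcalc_def by blast
qed

lemma fcalc_const: "fcalc A M (\<lambda>_. c) (c *\<^sub>R id_blinfun)"
  using fcalc_poly[of A M "[:c:]"] by (simp add: poly_op_pCons poly_pCons[abs_def])

lemma fcalc_ident: "fcalc A M (\<lambda>x. x) A"
proof -
  have "poly_op [:0, 1:] A = A"
    by (auto intro: blinfun_eqI simp: poly_op_pCons blinfun.bilinear_simps)
  then show ?thesis using fcalc_poly[of A M "[:0, 1:]"] by (simp add: poly_pCons[abs_def])
qed

lemma fcalc_poly_compose:
  assumes "fcalc A M \<phi> T"
  shows "fcalc A M (\<lambda>x. poly p (\<phi> x)) (poly_op p T)"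
proof (induction p)
  case 0
  then show ?case using fcalc_const[of A M 0] by simp
next
  case (pCons a p)
  then show ?case
    using assms unfolding poly_op_pCons poly_pCons
    by (intro fcalc_add fcalc_mult fcalc_const)
qed

lemma selfadjoint_fcalc:
  assumes "fcalc A M \<phi> T" "selfadjoint A"
  shows "selfadjoint T"
  using assms selfadjoint_limit selfadjoint_poly_op unfolding fcalc_def by metis

lemma complex_linear_op_fcalc:
  assumes "fcalc A M \<phi> T" "complex_linear_op A"
  shows "complex_linear_op T"
  using assms complex_linear_op_limit complex_linear_op_poly_op unfolding fcalc_def by metis

section \<open>Inverses and square roots\<close>

text \<open>Both products of \<open>T\<close> with the operator of the reciprocal function belong to
  the constant function 1, so uniqueness makes them the identity.\<close>

lemma fcalc_inverse:
  assumes A: "positive_op A" "norm A \<le> M" and T: "fcalc A M \<phi> T"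
    and nz: "\<And>x. x \<in> {0..M} \<Longrightarrow> \<phi> x \<noteq> 0"
  obtains R where "fcalc A M (\<lambda>x. inverse (\<phi> x)) R" "R o\<^sub>L T = id_blinfun" "T o\<^sub>L R = id_blinfun"
proof -
  have cont: "continuous_on {0..M} (\<lambda>x. inverse (\<phi> x))"
    using continuous_on_fcalc[OF T] nz by (intro continuous_intros) auto
  obtain R where R: "fcalc A M (\<lambda>x. inverse (\<phi> x)) R"
    using fcalc_exists[OF A cont] by blast
  have "fcalc A M (\<lambda>x. inverse (\<phi> x) * \<phi> x) (R o\<^sub>L T)" "fcalc A M (\<lambda>x. \<phi> x * inverse (\<phi> x)) (T o\<^sub>L R)"
    by (intro fcalc_mult R T)+
  then have "fcalc A M (\<lambda>x. 1) (R o\<^sub>L T)" "fcalc A M (\<lambda>x. 1) (T o\<^sub>L R)"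
    by (auto elim!: fcalc_cong simp: nz)
  then have "R o\<^sub>L T = id_blinfun" "T o\<^sub>L R = id_blinfun"
    using fcalc_unique[OF A _ fcalc_const[of A M 1]] by auto
  with R show ?thesis using that by blast
qed

lemma positive_op_shift_inverse:
  assumes "positive_op A" "c > 0"
  obtains R where "R o\<^sub>L (A + c *\<^sub>R id_blinfun) = id_blinfun" "(A + c *\<^sub>R id_blinfun) o\<^sub>L R = id_blinfun"
proof (rule fcalc_inverse[OF assms(1) order_refl])
  show "fcalc A (norm A) (\<lambda>x. x + c) (A + c *\<^sub>R id_blinfun)"
    by (intro fcalc_add fcalc_ident fcalc_const)
qed (use assms(2) that in auto)

lemma strictly_positive_op_sqrt:
  assumes "strictly_positive_op A"
  obtains S S' where "A = S o\<^sub>L S" "S' o\<^sub>L S = id_blinfun" "S o\<^sub>L S' = id_blinfun"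
    "selfadjoint S" "complex_linear_op S"
proof -
  have A: "positive_op A" "invertible_op A"
    using assms by (auto simp: strictly_positive_op_def)
  have cont: "continuous_on {0..norm A} sqrt" by (intro continuous_intros)
  obtain S where S: "fcalc A (norm A) sqrt S"
    using fcalc_exists[OF A(1) order_refl cont] by blast
  have "fcalc A (norm A) (\<lambda>x. sqrt x * sqrt x) (S o\<^sub>L S)"
    by (intro fcalc_mult S)
  then have "fcalc A (norm A) (\<lambda>x. x) (S o\<^sub>L S)" by (rule fcalc_cong) auto
  then have SS: "A = S o\<^sub>L S"
    using fcalc_unique[OF A(1) order_refl _ fcalc_ident] by metis
  let ?R = "inverse_op A"
  have R: "?R (S (S x)) = x" "S (S (?R x)) = x" for x
    using inverse_op[OF A(2)] unfolding SS
    by (metis blinfun_apply_blinfun_compose blinfun_apply_id_blinfun id_apply)+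
  \<comment> \<open>\<open>S\<close> sends both sides to \<open>S x\<close>, and \<open>S\<close> is
    injective because \<open>?R\<close> undoes \<open>S o\<^sub>L S\<close>. Thus
    \<open>S o\<^sub>L ?R\<close> is a left inverse of \<open>S\<close> too.\<close>
  have "S (?R (S x)) = x" for x
    using R by metis
  then show ?thesis
    by (intro that[OF SS, of "S o\<^sub>L ?R"] blinfun_eqI selfadjoint_fcalc[OF S] complex_linear_op_fcalc[OF S]
        positive_opD[OF A(1)]) (auto simp: R)
qed

section \<open>Weighted harmonic means\<close>

lemma inverse_op_apply:
  assumes "R o\<^sub>L T = id_blinfun"
  shows "R (T x) = x"
  using assms by (metis blinfun_apply_blinfun_compose blinfun_apply_id_blinfun id_apply)

text \<open>With \<open>W = (1 - t) *\<^sub>R Z + t *\<^sub>R X\<close>, the operator to be inverted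
  is \<open>W\<close> with the inverse of \<open>Z\<close> on its left and the inverse of
  \<open>X\<close> on its right. The resulting product still makes sense when \<open>X\<close> and
  \<open>Z\<close> are not invertible, provided \<open>W\<close> is.\<close>

lemma harmonic_formula_eq:
  assumes X: "invertible_op X" and Z: "invertible_op Z"
    and R: "R o\<^sub>L ((1 - t) *\<^sub>R Z + t *\<^sub>R X) = id_blinfun" "((1 - t) *\<^sub>R Z + t *\<^sub>R X) o\<^sub>L R = id_blinfun"
  shows "harmonic_formula t X Z = X o\<^sub>L R o\<^sub>L Z"
  unfolding harmonic_formula_def
proof (rule inverse_op_eqI; rule blinfun_eqI)
  note simps = inverse_op[OF X, THEN inverse_op_apply] inverse_op[OF Z, THEN inverse_op_apply]
  fix v
  have "X (R (Z ((1 - t) *\<^sub>R inverse_op X v + t *\<^sub>R inverse_op Z v)))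
      = X (R ((1 - t) *\<^sub>R Z (inverse_op X v) + t *\<^sub>R X (inverse_op X v)))"
    by (simp add: blinfun.bilinear_simps simps)
  also have "\<dots> = v"
    using inverse_op_apply[OF R(1), of "inverse_op X v"] by (simp add: blinfun.bilinear_simps simps)
  finally show "((X o\<^sub>L R o\<^sub>L Z) o\<^sub>L ((1 - t) *\<^sub>R inverse_op X + t *\<^sub>R inverse_op Z)) v = id_blinfun v"
    by (simp add: blinfun.bilinear_simps)
  define u where "u = R (Z v)"
  have "(1 - t) *\<^sub>R inverse_op X (X u) + t *\<^sub>R inverse_op Z (X u)
      = inverse_op Z ((1 - t) *\<^sub>R Z u + t *\<^sub>R X u)"
    by (simp add: blinfun.bilinear_simps simps)
  also have "(1 - t) *\<^sub>R Z u + t *\<^sub>R X u = Z v"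
    using inverse_op_apply[OF R(2), of "Z v"] by (simp add: blinfun.bilinear_simps u_def)
  finally show "(((1 - t) *\<^sub>R inverse_op X + t *\<^sub>R inverse_op Z) o\<^sub>L (X o\<^sub>L R o\<^sub>L Z)) v = id_blinfun v"
    by (simp add: blinfun.bilinear_simps simps u_def)
qed

lemma invertible_op_shift:
  assumes "positive_op A" "\<epsilon> > 0"
  shows "invertible_op (A + \<epsilon> *\<^sub>R id_blinfun)"
  using positive_op_shift_inverse[OF assms] unfolding invertible_op_def by metis

text \<open>Treats both branches of the definition at once. Norm convergence gives the pointwise
  limits, and uniqueness of limits evaluates the definite description.\<close>

lemma weighted_harmonic_mean_eqI:
  fixes A B :: "'a::chilbert_space \<Rightarrow>\<^sub>L 'a"
  assumes "strictly_positive_op A \<Longrightarrow> strictly_positive_op B \<Longrightarrow> harmonic_formula t A B = L"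
    and lim: "((\<lambda>\<epsilon>. harmonic_formula t (A + \<epsilon> *\<^sub>R id_blinfun) (B + \<epsilon> *\<^sub>R id_blinfun)) \<longlongrightarrow> L) (at_right 0)"
  shows "weighted_harmonic_mean t A B = L"
proof -
  let ?F = "\<lambda>\<epsilon>. harmonic_formula t (A + \<epsilon> *\<^sub>R id_blinfun) (B + \<epsilon> *\<^sub>R id_blinfun)"
  have L: "((\<lambda>\<epsilon>. ?F \<epsilon> x) \<longlongrightarrow> L x) (at_right 0)" for x
    by (intro tendsto_intros lim)
  have "(THE T :: 'a \<Rightarrow>\<^sub>L 'a. \<forall>x. ((\<lambda>\<epsilon>. ?F \<epsilon> x) \<longlongrightarrow> T x) (at_right 0)) = L"
    by (rule the_equality) (auto simp: L intro!: blinfun_eqI tendsto_unique[OF trivial_limit_at_right_real _ L])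
  then show ?thesis
    using assms(1) by (simp add: weighted_harmonic_mean_def)
qed

text \<open>This case stands apart from \<open>weighted_harmonic_mean_eq\<close> because at
  \<open>t = 1\<close> the weighted sum is \<open>A\<close>, which need not be invertible.\<close>

lemma weighted_harmonic_mean_1:
  assumes "positive_op A" "positive_op B"
  shows "weighted_harmonic_mean 1 A B = B"
proof (rule weighted_harmonic_mean_eqI)
  have eq: "harmonic_formula 1 X Z = Z" if "invertible_op Z" for X Z :: "'a \<Rightarrow>\<^sub>L 'a"
    unfolding harmonic_formula_def using inverse_op[OF that] by (auto intro: inverse_op_eqI)
  then show "harmonic_formula 1 A B = B" if "strictly_positive_op B"
    using that by (simp add: strictly_positive_op_def)
  have "((\<lambda>\<epsilon>. B + \<epsilon> *\<^sub>R id_blinfun) \<longlongrightarrow> B + 0 *\<^sub>R id_blinfun) (at_right 0)"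
    by (intro tendsto_intros)
  moreover have "\<forall>\<^sub>F \<epsilon> in at_right 0. B + \<epsilon> *\<^sub>R id_blinfun
      = harmonic_formula 1 (A + \<epsilon> *\<^sub>R id_blinfun) (B + \<epsilon> *\<^sub>R id_blinfun)"
    using eventually_at_right_less by eventually_elim (simp add: eq invertible_op_shift assms)
  ultimately show "((\<lambda>\<epsilon>. harmonic_formula 1 (A + \<epsilon> *\<^sub>R id_blinfun) (B + \<epsilon> *\<^sub>R id_blinfun)) \<longlongrightarrow> B) (at_right 0)"
    by (simp add: tendsto_cong)
qed

text \<open>The resolvent identity writes \<open>R' - R\<close> as \<open>- \<epsilon>\<close> times
  \<open>R o\<^sub>L R'\<close>. Positivity of \<open>R\<close> shows that \<open>R' x\<close> is no
  longer than \<open>R x\<close>.\<close>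

lemma norm_shift_inverse_diff_le:
  assumes W: "positive_op W" "R o\<^sub>L W = id_blinfun" "W o\<^sub>L R = id_blinfun"
    and "\<epsilon> > 0" and R': "(W + \<epsilon> *\<^sub>R id_blinfun) o\<^sub>L R' = id_blinfun"
  shows "norm (R' - R) \<le> \<epsilon> * (norm R)\<^sup>2"
proof (rule norm_blinfun_bound)
  fix x
  define z where "z = R' x"
  have "W z + \<epsilon> *\<^sub>R z = x"
    using inverse_op_apply[OF R', of x] by (simp add: z_def blinfun.bilinear_simps)
  then have z: "z + \<epsilon> *\<^sub>R R z = R x"
    using inverse_op_apply[OF W(2), of z] by (metis blinfun.add_right blinfun.scaleR_right)
  have "0 \<le> rinner (R z) z"
    using positive_opD(3)[OF W(1), of "R z"] inverse_op_apply[OF W(3), of z]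
    by (simp add: rinner_commute)
  then have "norm z * norm z \<le> rinner (z + \<epsilon> *\<^sub>R R z) z"
    using \<open>\<epsilon> > 0\<close> by (simp add: rinner.add_left rinner.scaleR_left rinner_self power2_eq_square)
  also have "\<dots> \<le> norm (R x) * norm z"
    unfolding z using rinner_Cauchy_Schwarz[of "R x" z] by linarith
  finally have "norm z \<le> norm (R x)"
    by (cases "z = 0") auto
  then have "norm z \<le> norm R * norm x" using norm_blinfun[of R x] by linarith
  have "norm ((R' - R) x) = \<epsilon> * norm (R z)"
    using z \<open>\<epsilon> > 0\<close>
    by (metis (no_types) z_def add_diff_cancel_left' blinfun.diff_left norm_minus_commute norm_scaleR abs_of_pos)
  also have "\<dots> \<le> \<epsilon> * (norm R * (norm R * norm x))"
    using \<open>\<epsilon> > 0\<close> norm_blinfun[of R z] mult_left_mono[OF \<open>norm z \<le> norm R * norm x\<close>, of "norm R"]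
    by (intro mult_left_mono) auto
  finally show "norm ((R' - R) x) \<le> \<epsilon> * (norm R)\<^sup>2 * norm x"
    by (simp add: power2_eq_square mult_ac)
qed (use \<open>\<epsilon> > 0\<close> in simp)

lemma positive_op_add: "positive_op A \<Longrightarrow> positive_op B \<Longrightarrow> positive_op (A + B)"
  by (auto simp: positive_op_iff blinfun.bilinear_simps rinner.add_left)

lemma positive_op_scaleR: "positive_op A \<Longrightarrow> r \<ge> 0 \<Longrightarrow> positive_op (r *\<^sub>R A)"
  by (auto simp: positive_op_iff blinfun.bilinear_simps rinner.scaleR_left)

lemma positive_op_id: "positive_op id_blinfun"
  by (auto simp: positive_op_iff rinner_self)

text \<open>Only the weighted sum has to be invertible. Its shifted inverses converge to
  \<open>R\<close> in norm, so the product formula of \<open>harmonic_formula_eq\<close> converges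
  as well.\<close>

lemma weighted_harmonic_mean_eq:
  assumes A: "positive_op A" and B: "positive_op B" and t: "0 \<le> t" "t \<le> 1"
    and R: "R o\<^sub>L ((1 - t) *\<^sub>R B + t *\<^sub>R A) = id_blinfun" "((1 - t) *\<^sub>R B + t *\<^sub>R A) o\<^sub>L R = id_blinfun"
  shows "weighted_harmonic_mean t A B = A o\<^sub>L R o\<^sub>L B"
proof (rule weighted_harmonic_mean_eqI)
  show "harmonic_formula t A B = A o\<^sub>L R o\<^sub>L B" if "strictly_positive_op A" "strictly_positive_op B"
    using that by (intro harmonic_formula_eq R) (auto simp: strictly_positive_op_def)
  let ?W = "(1 - t) *\<^sub>R B + t *\<^sub>R A"
  have W: "positive_op ?W"
    using t A B by (intro positive_op_add positive_op_scaleR) auto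
  define R' where "R' \<epsilon> = inverse_op (?W + \<epsilon> *\<^sub>R id_blinfun)" for \<epsilon>
  have pos: "\<forall>\<^sub>F \<epsilon> in at_right (0::real). 0 < \<epsilon>"
    by (rule eventually_at_right_less)
  note R' = inverse_op[OF invertible_op_shift[OF W], folded R'_def]
  have "((\<lambda>\<epsilon>. R' \<epsilon> - R) \<longlongrightarrow> 0) (at_right 0)"
  proof (rule Lim_null_comparison)
    show "\<forall>\<^sub>F \<epsilon> in at_right 0. norm (R' \<epsilon> - R) \<le> \<epsilon> * (norm R)\<^sup>2"
      using pos by eventually_elim (intro norm_shift_inverse_diff_le[OF W R] R')
    have "((\<lambda>\<epsilon>. \<epsilon> * (norm R)\<^sup>2) \<longlongrightarrow> 0 * (norm R)\<^sup>2) (at_right 0)"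
      by (intro tendsto_intros)
    then show "((\<lambda>\<epsilon>. \<epsilon> * (norm R)\<^sup>2) \<longlongrightarrow> 0) (at_right 0)" by simp
  qed
  then have "(R' \<longlongrightarrow> R) (at_right 0)" by (rule LIM_zero_cancel)
  then have "((\<lambda>\<epsilon>. (A + \<epsilon> *\<^sub>R id_blinfun) o\<^sub>L R' \<epsilon> o\<^sub>L (B + \<epsilon> *\<^sub>R id_blinfun))
      \<longlongrightarrow> (A + 0 *\<^sub>R id_blinfun) o\<^sub>L R o\<^sub>L (B + 0 *\<^sub>R id_blinfun)) (at_right 0)"
    by (intro tendsto_intros blinfun_compose.tendsto)
  moreover have "\<forall>\<^sub>F \<epsilon> in at_right 0. (A + \<epsilon> *\<^sub>R id_blinfun) o\<^sub>L R' \<epsilon> o\<^sub>L (B + \<epsilon> *\<^sub>R id_blinfun)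
      = harmonic_formula t (A + \<epsilon> *\<^sub>R id_blinfun) (B + \<epsilon> *\<^sub>R id_blinfun)"
    using pos
  proof eventually_elim
    case (elim \<epsilon>)
    \<comment> \<open>The weights add up to 1, so shifting both arguments by
      \<open>\<epsilon>\<close> shifts the weighted sum by exactly
      \<open>\<epsilon>\<close>.\<close>
    have "(1 - t) *\<^sub>R (B + \<epsilon> *\<^sub>R id_blinfun) + t *\<^sub>R (A + \<epsilon> *\<^sub>R id_blinfun) = ?W + \<epsilon> *\<^sub>R id_blinfun"
      by (simp add: algebra_simps)
    then show ?case
      using R'[OF elim] by (intro harmonic_formula_eq[symmetric] invertible_op_shift A B elim) simp_all
  qed
  ultimately show "((\<lambda>\<epsilon>. harmonic_formula t (A + \<epsilon> *\<^sub>R id_blinfun) (B + \<epsilon> *\<^sub>R id_blinfun))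
      \<longlongrightarrow> A o\<^sub>L R o\<^sub>L B) (at_right 0)"
    by (simp add: tendsto_cong)
qed

section \<open>Harmonic means with the identity and their scalar functions\<close>

text \<open>The scalar mean \<open>x !_t 1\<close>. At \<open>t = 1\<close> the quotient would be
  \<open>x / x\<close>, which is 0 at \<open>x = 0\<close>, whereas the mean is 1 there.\<close>

definition harmonic_fun :: "real \<Rightarrow> real \<Rightarrow> real" where
  "harmonic_fun t x = (if t = 1 then 1 else x / (1 - t + t * x))"

lemma harmonic_denominator_pos:
  fixes t x :: real
  assumes "0 \<le> t" "t < 1" "0 \<le> x"
  shows "0 < 1 - t + t * x"
  using assms by (intro add_pos_nonneg) auto

text \<open>For \<open>t < 1\<close> the denominator is positive on \<open>{0..M}\<close>, so the
  weighted sum is invertible by the calculus even if \<open>A\<close> is not.\<close>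

lemma weighted_harmonic_mean_id:
  assumes A: "positive_op A" "norm A \<le> M" and t: "0 \<le> t" "t < 1"
  obtains R where "fcalc A M (\<lambda>x. inverse (1 - t + t * x)) R"
    "R o\<^sub>L ((1 - t) *\<^sub>R id_blinfun + t *\<^sub>R A) = id_blinfun"
    "((1 - t) *\<^sub>R id_blinfun + t *\<^sub>R A) o\<^sub>L R = id_blinfun"
    "weighted_harmonic_mean t A id_blinfun = A o\<^sub>L R"
proof -
  let ?W = "(1 - t) *\<^sub>R id_blinfun + t *\<^sub>R A"
  have "fcalc A M (\<lambda>x. t * x) ((t *\<^sub>R id_blinfun) o\<^sub>L A)"
    by (intro fcalc_mult fcalc_const fcalc_ident)
  moreover have "(t *\<^sub>R id_blinfun) o\<^sub>L A = t *\<^sub>R A"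
    by (auto intro: blinfun_eqI simp: blinfun.bilinear_simps)
  ultimately have W: "fcalc A M (\<lambda>x. 1 - t + t * x) ?W"
    by (auto intro: fcalc_add fcalc_const)
  obtain R where R: "fcalc A M (\<lambda>x. inverse (1 - t + t * x)) R"
    "R o\<^sub>L ?W = id_blinfun" "?W o\<^sub>L R = id_blinfun"
  proof (rule fcalc_inverse[OF A W])
    show "1 - t + t * x \<noteq> 0" if "x \<in> {0..M}" for x
      using harmonic_denominator_pos[OF t, of x] that by auto
  qed
  have "weighted_harmonic_mean t A id_blinfun = A o\<^sub>L R o\<^sub>L id_blinfun"
    using t by (intro weighted_harmonic_mean_eq A positive_op_id R) auto
  also have "\<dots> = A o\<^sub>L R" by (auto intro: blinfun_eqI)
  finally show ?thesis using R that by blast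
qed

lemma fcalc_weighted_harmonic_mean:
  assumes A: "positive_op A" "norm A \<le> M" and t: "0 \<le> t" "t \<le> 1"
  shows "fcalc A M (harmonic_fun t) (weighted_harmonic_mean t A id_blinfun)"
proof (cases "t = 1")
  case True
  then show ?thesis
    using fcalc_const[of A M 1] A by (simp add: harmonic_fun_def[abs_def] weighted_harmonic_mean_1 positive_op_id)
next
  case False
  then have t: "0 \<le> t" "t < 1" using t by auto
  obtain R where R: "fcalc A M (\<lambda>x. inverse (1 - t + t * x)) R"
    "weighted_harmonic_mean t A id_blinfun = A o\<^sub>L R"
    using weighted_harmonic_mean_id[OF A t] by blast
  have "fcalc A M (\<lambda>x. x * inverse (1 - t + t * x)) (A o\<^sub>L R)"
    by (intro fcalc_mult R fcalc_ident)
  then show ?thesis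
    unfolding R(2) by (rule fcalc_cong) (use t in \<open>simp add: harmonic_fun_def divide_inverse\<close>)
qed

section \<open>Congruence by an invertible self-adjoint operator\<close>

lemma positive_op_congruence:
  assumes "positive_op B" "selfadjoint S" "complex_linear_op S"
  shows "positive_op (S o\<^sub>L B o\<^sub>L S)"
proof -
  have "rinner (S (B (S x))) y = rinner (B (S x)) (S y)" "rinner x (S (B (S y))) = rinner (S x) (B (S y))"
    for x y using assms(2) by (simp_all add: selfadjoint_def)
  then have "selfadjoint (S o\<^sub>L B o\<^sub>L S)" "0 \<le> rinner ((S o\<^sub>L B o\<^sub>L S) x) x" for x
    using positive_opD[OF assms(1)] by (simp_all add: selfadjoint_def)
  then show ?thesis
    using assms(3) positive_opD(1)[OF assms(1)] by (auto simp: positive_op_iff)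
qed

text \<open>The weighted sum of the congruent pair is the old one with \<open>S\<close> on both
  sides, so its inverse is \<open>?R\<close>; the inner factors \<open>S\<close> and
  \<open>S'\<close> then cancel. At \<open>t = 1\<close> the weighted sum may fail to be invertible
  and the mean is the second argument.\<close>

lemma weighted_harmonic_mean_congruence:
  assumes B: "positive_op B" and t: "0 \<le> t" "t \<le> 1"
    and S: "S' o\<^sub>L S = id_blinfun" "S o\<^sub>L S' = id_blinfun" "selfadjoint S" "complex_linear_op S"
  shows "weighted_harmonic_mean t (S o\<^sub>L B o\<^sub>L S) (S o\<^sub>L S)
    = S o\<^sub>L weighted_harmonic_mean t B id_blinfun o\<^sub>L S"
proof -
  have pos: "positive_op (S o\<^sub>L B o\<^sub>L S)"
    by (intro positive_op_congruence B S)
  have "S o\<^sub>L id_blinfun o\<^sub>L S = S o\<^sub>L S" by (auto intro: blinfun_eqI)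
  then have posSS: "positive_op (S o\<^sub>L S)"
    using positive_op_congruence[OF positive_op_id S(3,4)] by simp
  show ?thesis
  proof (cases "t = 1")
    case True
    then show ?thesis
      using weighted_harmonic_mean_1[OF pos posSS] weighted_harmonic_mean_1[OF B positive_op_id]
      by (auto intro: blinfun_eqI)
  next
    case False
    then have "t < 1" using t by simp
    obtain R where R: "R o\<^sub>L ((1 - t) *\<^sub>R id_blinfun + t *\<^sub>R B) = id_blinfun"
      "((1 - t) *\<^sub>R id_blinfun + t *\<^sub>R B) o\<^sub>L R = id_blinfun"
      "weighted_harmonic_mean t B id_blinfun = B o\<^sub>L R"
      using weighted_harmonic_mean_id[OF B order_refl t(1) \<open>t < 1\<close>] by blast
    note simps = S(1,2)[THEN inverse_op_apply]
    let ?R = "S' o\<^sub>L R o\<^sub>L S'"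
    have "weighted_harmonic_mean t (S o\<^sub>L B o\<^sub>L S) (S o\<^sub>L S) = (S o\<^sub>L B o\<^sub>L S) o\<^sub>L ?R o\<^sub>L (S o\<^sub>L S)"
    proof (rule weighted_harmonic_mean_eq[OF pos posSS t]; rule blinfun_eqI)
      fix x
      have "(1 - t) *\<^sub>R S (S x) + t *\<^sub>R S (B (S x)) = S ((1 - t) *\<^sub>R S x + t *\<^sub>R B (S x))" for x
        by (simp add: blinfun.bilinear_simps)
      note W = this
      show "(?R o\<^sub>L ((1 - t) *\<^sub>R (S o\<^sub>L S) + t *\<^sub>R (S o\<^sub>L B o\<^sub>L S))) x = id_blinfun x"
        using inverse_op_apply[OF R(1), of "S x"] W[of x] by (simp add: blinfun.add_left blinfun.scaleR_left simps)
      show "(((1 - t) *\<^sub>R (S o\<^sub>L S) + t *\<^sub>R (S o\<^sub>L B o\<^sub>L S)) o\<^sub>L ?R) x = id_blinfun x"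
        using inverse_op_apply[OF R(2), of "S' x"] W[of "S' (R (S' x))"]
        by (simp add: blinfun.add_left blinfun.scaleR_left simps)
    qed
    also have "\<dots> = S o\<^sub>L (B o\<^sub>L R) o\<^sub>L S"
      by (auto intro: blinfun_eqI simp: simps)
    finally show ?thesis by (simp add: R(3))
  qed
qed

lemma poly_op_scaleR_id: "poly_op p (r *\<^sub>R id_blinfun) = poly p r *\<^sub>R id_blinfun"
  by (induction p) (auto intro: blinfun_eqI simp: poly_op_pCons blinfun.bilinear_simps algebra_simps)

lemma fcalc_scaleR_id:
  assumes "fcalc (r *\<^sub>R id_blinfun) M \<phi> T" "r \<in> {0..M}"
  shows "T = \<phi> r *\<^sub>R id_blinfun"
proof -
  obtain p where p: "uniform_limit {0..M} (\<lambda>n. poly (p n)) \<phi> sequentially"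
      "(\<lambda>n. poly (p n) r *\<^sub>R id_blinfun) \<longlonglongrightarrow> T"
    using assms(1) unfolding fcalc_def poly_op_scaleR_id by metis
  have "(\<lambda>n. poly (p n) r *\<^sub>R id_blinfun) \<longlonglongrightarrow> \<phi> r *\<^sub>R (id_blinfun :: 'a \<Rightarrow>\<^sub>L 'a)"
    by (intro tendsto_intros tendsto_uniform_limitI[OF p(1) assms(2)])
  then show ?thesis using p(2) LIMSEQ_unique by blast
qed

text \<open>The scalar congruence by \<open>sqrt x\<close> carries the pair of
  \<open>(1 / x) *\<^sub>R id_blinfun\<close> and the identity to the pair in question.\<close>

lemma weighted_harmonic_mean_id_scaleR:
  assumes "0 \<le> t" "t \<le> 1" "x > 0"
  shows "weighted_harmonic_mean t id_blinfun (x *\<^sub>R id_blinfun :: 'a::chilbert_space \<Rightarrow>\<^sub>L 'a)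
    = (x * harmonic_fun t (1 / x)) *\<^sub>R id_blinfun"
proof -
  define B :: "'a \<Rightarrow>\<^sub>L 'a" where "B = (1 / x) *\<^sub>R id_blinfun"
  define S :: "'a \<Rightarrow>\<^sub>L 'a" where "S = sqrt x *\<^sub>R id_blinfun"
  define S' :: "'a \<Rightarrow>\<^sub>L 'a" where "S' = (1 / sqrt x) *\<^sub>R id_blinfun"
  have B: "positive_op B"
    unfolding B_def using assms by (intro positive_op_scaleR positive_op_id) auto
  have SS: "S o\<^sub>L S = x *\<^sub>R id_blinfun" "S o\<^sub>L B o\<^sub>L S = id_blinfun"
    using assms by (auto intro!: blinfun_eqI simp: S_def B_def blinfun.bilinear_simps)
  have "weighted_harmonic_mean t (S o\<^sub>L B o\<^sub>L S) (S o\<^sub>L S)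
    = S o\<^sub>L weighted_harmonic_mean t B id_blinfun o\<^sub>L S"
    using assms by (intro weighted_harmonic_mean_congruence[of B t S'] B)
      (auto simp: S_def S'_def blinfun.bilinear_simps intro!: blinfun_eqI)
  moreover have "weighted_harmonic_mean t B id_blinfun = harmonic_fun t (1 / x) *\<^sub>R id_blinfun"
  proof -
    \<comment> \<open>The maximum puts \<open>1 / x\<close> into the interval even in the zero
      space, where \<open>norm B\<close> is 0.\<close>
    have "fcalc B (max (norm B) (1 / x)) (harmonic_fun t) (weighted_harmonic_mean t B id_blinfun)"
      by (intro fcalc_weighted_harmonic_mean B assms) simp
    from fcalc_scaleR_id[OF this[unfolded B_def]] show ?thesis
      using assms unfolding B_def by simp
  qed
  ultimately have "weighted_harmonic_mean t id_blinfun (x *\<^sub>R id_blinfun)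
      = S o\<^sub>L (harmonic_fun t (1 / x) *\<^sub>R id_blinfun) o\<^sub>L S"
    unfolding SS by simp
  also have "\<dots> = (x * harmonic_fun t (1 / x)) *\<^sub>R id_blinfun"
    using assms by (auto intro!: blinfun_eqI simp: S_def blinfun.bilinear_simps)
  finally show ?thesis .
qed

section \<open>Averages of weighted harmonic means\<close>

locale finite_measure_unit_interval = finite_measure \<mu> for \<mu> :: "real measure" +
  assumes sets_eq: "sets \<mu> = sets borel01"
begin

lemma space_eq: "space \<mu> = {0..1}"
  using sets_eq_imp_space_eq[OF sets_eq] by (simp add: space_restrict_space)

lemma borel_measurable_if_borel: "f \<in> borel_measurable borel \<Longrightarrow> f \<in> borel_measurable \<mu>"
  unfolding measurable_cong_sets[OF sets_eq refl] by (rule measurable_restrict_space1)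

lemma integrable_if_bounded:
  fixes f :: "real \<Rightarrow> real"
  assumes "f \<in> borel_measurable borel" "\<And>t. t \<in> {0..1} \<Longrightarrow> \<bar>f t\<bar> \<le> b"
  shows "integrable \<mu> f"
  using assms by (intro integrable_const_bound[of f b] borel_measurable_if_borel) (auto simp: space_eq)

end

section \<open>Averaging families of polynomials\<close>

definition poly_linear :: "(real poly \<Rightarrow> real) \<Rightarrow> bool" where
  "poly_linear L \<longleftrightarrow> (\<forall>p q. L (p + q) = L p + L q) \<and> (\<forall>r p. L (smult r p) = r * L p)"

text \<open>The polynomial \<open>q = \<integral> c(t) F\<^sub>t d\<mu>(t)\<close> is described through linear functionals, so that it can be
  evaluated both at numbers and at operators. Quantifying over the weight \<open>c\<close> makes the class of
  admissible \<open>F\<close> closed under multiplication by bounded functions of \<open>t\<close>.\<close>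

definition averages_to_poly :: "real measure \<Rightarrow> (real \<Rightarrow> real poly) \<Rightarrow> bool" where
  "averages_to_poly \<mu> F \<longleftrightarrow>
    (\<forall>c. c \<in> borel_measurable borel \<longrightarrow> (\<exists>b. \<forall>t\<in>{0..1}. \<bar>c t\<bar> \<le> b) \<longrightarrow>
      (\<exists>q. \<forall>L. poly_linear L \<longrightarrow>
        integrable \<mu> (\<lambda>t. c t * L (F t)) \<and> (LINT t|\<mu>. c t * L (F t)) = L q))"

lemma averages_to_poly_add:
  assumes "averages_to_poly \<mu> F" "averages_to_poly \<mu> G"
  shows "averages_to_poly \<mu> (\<lambda>t. F t + G t)"
  unfolding averages_to_poly_def
proof (intro allI impI)
  fix c :: "real \<Rightarrow> real" assume c: "c \<in> borel_measurable borel" "\<exists>b. \<forall>t\<in>{0..1}. \<bar>c t\<bar> \<le> b"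
  obtain p where p: "\<And>L. poly_linear L \<Longrightarrow> integrable \<mu> (\<lambda>t. c t * L (F t))"
      "\<And>L. poly_linear L \<Longrightarrow> (LINT t|\<mu>. c t * L (F t)) = L p"
    using assms(1) c unfolding averages_to_poly_def by metis
  obtain q where q: "\<And>L. poly_linear L \<Longrightarrow> integrable \<mu> (\<lambda>t. c t * L (G t))"
      "\<And>L. poly_linear L \<Longrightarrow> (LINT t|\<mu>. c t * L (G t)) = L q"
    using assms(2) c unfolding averages_to_poly_def by metis
  show "\<exists>q. \<forall>L. poly_linear L \<longrightarrow>
      integrable \<mu> (\<lambda>t. c t * L (F t + G t)) \<and> (LINT t|\<mu>. c t * L (F t + G t)) = L q"
  proof (intro exI[of _ "p + q"] allI impI)
    fix L assume L: "poly_linear L"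
    have "(\<lambda>t. c t * L (F t + G t)) = (\<lambda>t. c t * L (F t) + c t * L (G t))"
      using L by (auto simp: poly_linear_def algebra_simps)
    then show "integrable \<mu> (\<lambda>t. c t * L (F t + G t)) \<and> (LINT t|\<mu>. c t * L (F t + G t)) = L (p + q)"
      using p[OF L] q[OF L] L by (simp add: poly_linear_def)
  qed
qed

lemma averages_to_poly_smult:
  assumes F: "averages_to_poly \<mu> F" and a: "a \<in> borel_measurable borel" "\<And>t. t \<in> {0..1} \<Longrightarrow> \<bar>a t\<bar> \<le> b"
  shows "averages_to_poly \<mu> (\<lambda>t. smult (a t) (F t))"
  unfolding averages_to_poly_def
proof (intro allI impI)
  fix c :: "real \<Rightarrow> real" assume c: "c \<in> borel_measurable borel" "\<exists>b. \<forall>t\<in>{0..1}. \<bar>c t\<bar> \<le> b"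
  then obtain b' where b': "\<forall>t\<in>{0..1}. \<bar>c t\<bar> \<le> b'" by blast
  then have "\<forall>t\<in>{0..1}. \<bar>c t * a t\<bar> \<le> b' * b"
    using a(2) by (auto simp: abs_mult intro!: mult_mono intro: order_trans[OF abs_ge_zero])
  moreover have "(\<lambda>t. c t * a t) \<in> borel_measurable borel" using a c by measurable
  ultimately obtain q where q: "\<And>L. poly_linear L \<Longrightarrow> integrable \<mu> (\<lambda>t. c t * a t * L (F t))"
      "\<And>L. poly_linear L \<Longrightarrow> (LINT t|\<mu>. c t * a t * L (F t)) = L q"
    using F[unfolded averages_to_poly_def, rule_format, of "\<lambda>t. c t * a t"] by blast
  show "\<exists>q. \<forall>L. poly_linear L \<longrightarrow> integrable \<mu> (\<lambda>t. c t * L (smult (a t) (F t))) \<and>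
      (LINT t|\<mu>. c t * L (smult (a t) (F t))) = L q"
  proof (intro exI[of _ q] allI impI)
    fix L assume L: "poly_linear L"
    then have "(\<lambda>t. c t * L (smult (a t) (F t))) = (\<lambda>t. c t * a t * L (F t))"
      by (auto simp: poly_linear_def)
    then show "integrable \<mu> (\<lambda>t. c t * L (smult (a t) (F t))) \<and>
        (LINT t|\<mu>. c t * L (smult (a t) (F t))) = L q"
      using q[OF L] by simp
  qed
qed

text \<open>Multiplication by the variable is absorbed into the functional, which stays
  linear.\<close>

lemma averages_to_poly_shift:
  assumes "averages_to_poly \<mu> F"
  shows "averages_to_poly \<mu> (\<lambda>t. pCons 0 (F t))"
  unfolding averages_to_poly_def
proof (intro allI impI)
  fix c :: "real \<Rightarrow> real" assume c: "c \<in> borel_measurable borel" "\<exists>b. \<forall>t\<in>{0..1}. \<bar>c t\<bar> \<le> b"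
  obtain p where p: "\<And>L. poly_linear L \<Longrightarrow> integrable \<mu> (\<lambda>t. c t * L (F t))"
      "\<And>L. poly_linear L \<Longrightarrow> (LINT t|\<mu>. c t * L (F t)) = L p"
    using assms c unfolding averages_to_poly_def by metis
  have shift: "poly_linear (\<lambda>p. L (pCons 0 p))" if "poly_linear L" for L
    unfolding poly_linear_def
  proof (intro conjI allI)
    show "L (pCons 0 (p + q)) = L (pCons 0 p) + L (pCons 0 q)" for p q
      using that unfolding poly_linear_def by (metis add_pCons add_0)
    show "L (pCons 0 (smult r p)) = r * L (pCons 0 p)" for r p
      using that unfolding poly_linear_def by (metis smult_pCons mult_zero_right)
  qed
  show "\<exists>q. \<forall>L. poly_linear L \<longrightarrow> integrable \<mu> (\<lambda>t. c t * L (pCons 0 (F t))) \<and>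
      (LINT t|\<mu>. c t * L (pCons 0 (F t))) = L q"
    using p[OF shift] by (intro exI[of _ "pCons 0 p"]) auto
qed

lemma (in finite_measure_unit_interval) averages_to_poly_const:
  "averages_to_poly \<mu> (\<lambda>_. p)"
  unfolding averages_to_poly_def
proof (intro allI impI)
  fix c :: "real \<Rightarrow> real" assume c: "c \<in> borel_measurable borel" "\<exists>b. \<forall>t\<in>{0..1}. \<bar>c t\<bar> \<le> b"
  then have "integrable \<mu> c" using integrable_if_bounded by blast
  then show "\<exists>q. \<forall>L. poly_linear L \<longrightarrow>
      integrable \<mu> (\<lambda>t. c t * L p) \<and> (LINT t|\<mu>. c t * L p) = L q"
    by (intro exI[of _ "smult (LINT t|\<mu>. c t) p"]) (auto simp: poly_linear_def)
qed

text \<open>The Neumann approximations of \<^term>\<open>harmonic_fun t\<close>: writing \<open>u = 1 - (1 - t + t * x) / M\<close>,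
  the function satisfies \<open>h = x / M + u * h\<close>, and this equation is iterated. The starting value
  makes the iteration stationary at \<open>t = 1\<close>, where it would not converge uniformly near \<open>x = 0\<close>.\<close>

primrec harmonic_approx :: "real \<Rightarrow> nat \<Rightarrow> real \<Rightarrow> real poly" where
  "harmonic_approx M 0 t = [:of_bool (t = 1):]"
| "harmonic_approx M (Suc n) t =
    [:0, 1 / M:] + [:1 - (1 - t) / M, - t / M:] * harmonic_approx M n t"

lemma (in finite_measure_unit_interval) averages_to_poly_harmonic_approx:
  assumes "M \<ge> 1"
  shows "averages_to_poly \<mu> (harmonic_approx M n)"
proof (induction n)
  case 0
  have "averages_to_poly \<mu> (\<lambda>t. smult (of_bool (t = 1)) 1)"
    by (intro averages_to_poly_smult[where b = 1] averages_to_poly_const) auto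
  then show ?case by (simp add: one_pCons harmonic_approx.simps(1)[abs_def])
next
  case (Suc n)
  have "averages_to_poly \<mu> (\<lambda>t. [:0, 1 / M:] + (smult (1 - (1 - t) / M) (harmonic_approx M n t)
      + smult (- t / M) (pCons 0 (harmonic_approx M n t))))"
    using assms by (intro averages_to_poly_add averages_to_poly_const averages_to_poly_smult[where b = 1]
        averages_to_poly_shift Suc) (auto simp: field_simps abs_le_iff)
  then show ?case by (simp add: harmonic_approx.simps(2)[abs_def])
qed

section \<open>Error of the Neumann approximation\<close>

lemma harmonic_fun_bounds:
  assumes "0 \<le> t" "t \<le> 1" "0 \<le> x" "x \<le> M" "1 \<le> M"
  shows "0 \<le> harmonic_fun t x" "harmonic_fun t x \<le> M"
proof -
  have "x \<le> M * (1 - t + t * x)" if "t < 1"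
  proof -
    have "x * (1 - t) \<le> M * (1 - t)" "1 * (t * x) \<le> M * (t * x)"
      using assms by (intro mult_right_mono; simp)+
    then show ?thesis by (simp add: algebra_simps)
  qed
  then show "0 \<le> harmonic_fun t x" "harmonic_fun t x \<le> M"
    using assms harmonic_denominator_pos[of t x] by (auto simp: harmonic_fun_def divide_le_eq)
qed

lemma harmonic_fun_fixed_point:
  assumes "0 \<le> t" "t \<le> 1" "0 \<le> x" "1 \<le> M"
  shows "harmonic_fun t x = x / M + (1 - (1 - t + t * x) / M) * harmonic_fun t x"
proof -
  have "(1 - t + t * x) * harmonic_fun t x = x"
    using harmonic_denominator_pos[of t x] assms by (auto simp: harmonic_fun_def)
  then have "(1 - t + t * x) / M * harmonic_fun t x = x / M"
    by (metis times_divide_eq_left)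
  then show ?thesis by (simp only: left_diff_distrib)
qed

text \<open>Subtracting the fixed-point equation from the recursion multiplies the error by the same
  factor at every step.\<close>

lemma harmonic_approx_error:
  assumes "0 \<le> t" "t \<le> 1" "0 \<le> x" "1 \<le> M"
  shows "poly (harmonic_approx M n t) x - harmonic_fun t x
    = (1 - (1 - t + t * x) / M) ^ n * (of_bool (t = 1) - harmonic_fun t x)"
proof (induction n)
  case (Suc n)
  let ?u = "1 - (1 - t + t * x) / M"
  have "poly (harmonic_approx M (Suc n) t) x = x / M + ?u * poly (harmonic_approx M n t) x"
    by (simp add: diff_divide_distrib add_divide_distrib algebra_simps)
  then have "poly (harmonic_approx M (Suc n) t) x - harmonic_fun t x
      = ?u * (poly (harmonic_approx M n t) x - harmonic_fun t x)"
    using harmonic_fun_fixed_point[OF assms] by (simp only: right_diff_distrib)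
  then show ?case by (simp add: Suc)
qed simp

text \<open>A bound uniform in \<open>x\<close>: the contraction factor is largest at
  \<open>x = 0\<close>. At \<open>t = 1\<close> that factor would be 1, but the iteration is exact
  there.\<close>

definition harmonic_error :: "real \<Rightarrow> nat \<Rightarrow> real \<Rightarrow> real" where
  "harmonic_error M n t = (if t = 1 then 0 else (1 - (1 - t) / M) ^ n * M)"

lemma harmonic_approx_le:
  assumes t: "0 \<le> t" "t \<le> 1" and x: "0 \<le> x" "x \<le> M" and M: "1 \<le> M"
  shows "\<bar>poly (harmonic_approx M n t) x - harmonic_fun t x\<bar> \<le> harmonic_error M n t"
proof (cases "t = 1")
  case True
  then show ?thesis
    using harmonic_approx_error[OF t x(1) M] by (simp add: harmonic_error_def harmonic_fun_def)
next
  case False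
  let ?u = "1 - (1 - t + t * x) / M"
  have "1 - t + t * x \<le> (1 - t) * M + t * M"
    using assms mult_left_mono[of 1 M "1 - t"] mult_left_mono[of x M t] by (intro add_mono) auto
  then have "0 \<le> ?u" using M by (simp add: algebra_simps)
  moreover have "?u \<le> 1 - (1 - t) / M"
    using assms by (simp add: divide_right_mono)
  ultimately have "?u ^ n * harmonic_fun t x \<le> (1 - (1 - t) / M) ^ n * M"
    using harmonic_fun_bounds[OF t x M] by (intro mult_mono power_mono) auto
  then show ?thesis
    using harmonic_approx_error[OF t x(1) M, of n] False \<open>0 \<le> ?u\<close> harmonic_fun_bounds[OF t x M]
    by (simp add: harmonic_error_def abs_mult)
qed

lemma harmonic_error_bounds:
  assumes "0 \<le> t" "t \<le> 1" "1 \<le> M"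
  shows "0 \<le> harmonic_error M n t" "harmonic_error M n t \<le> M"
proof -
  have "0 \<le> 1 - (1 - t) / M" "1 - (1 - t) / M \<le> 1"
    using assms by (auto simp: field_simps)
  then have "0 \<le> (1 - (1 - t) / M) ^ n" "(1 - (1 - t) / M) ^ n \<le> 1"
    by (auto intro: power_le_one)
  then show "0 \<le> harmonic_error M n t" "harmonic_error M n t \<le> M"
    using assms by (auto simp: harmonic_error_def mult_le_cancel_right1)
qed

lemma harmonic_error_tendsto_0:
  assumes "0 \<le> t" "t \<le> 1" "1 \<le> M"
  shows "(\<lambda>n. harmonic_error M n t) \<longlonglongrightarrow> 0"
proof (cases "t = 1")
  case False
  then have "0 \<le> 1 - (1 - t) / M" "1 - (1 - t) / M < 1"
    using assms by (auto simp: field_simps)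
  then have "(\<lambda>n. (1 - (1 - t) / M) ^ n * M) \<longlonglongrightarrow> 0 * M"
    by (intro tendsto_intros LIMSEQ_realpow_zero)
  then show ?thesis using False by (simp add: harmonic_error_def)
qed (simp add: harmonic_error_def)

section \<open>Weak integrals\<close>

lemma has_weak_integral_rinner:
  assumes "has_weak_integral \<mu> F T"
  shows "integrable \<mu> (\<lambda>t. rinner (F t x) y)" "(LINT t|\<mu>. rinner (F t x) y) = rinner (T x) y"
proof -
  have "integrable \<mu> (\<lambda>t. cinner (F t x) y)" "(LINT t|\<mu>. cinner (F t x) y) = cinner (T x) y"
    using assms by (auto simp: has_weak_integral_def)
  then show "integrable \<mu> (\<lambda>t. rinner (F t x) y)" "(LINT t|\<mu>. rinner (F t x) y) = rinner (T x) y"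
    unfolding rinner_def by (auto simp: integral_Re)
qed

lemma has_weak_integral_unique:
  assumes "has_weak_integral \<mu> F S" "has_weak_integral \<mu> F T"
  shows "S = T"
proof (rule blinfun_eqI)
  show "S x = T x" for x
    by (rule eq_if_rinner_eq) (metis has_weak_integral_rinner(2) assms)
qed

lemma has_weak_integral_cong:
  assumes "\<And>t. t \<in> space \<mu> \<Longrightarrow> F t = G t"
  shows "has_weak_integral \<mu> F T \<longleftrightarrow> has_weak_integral \<mu> G T"
proof -
  have "integrable \<mu> (\<lambda>t. cinner (F t x) y) \<longleftrightarrow> integrable \<mu> (\<lambda>t. cinner (G t x) y)"
    "(LINT t|\<mu>. cinner (F t x) y) = (LINT t|\<mu>. cinner (G t x) y)" for x y
    using assms by (auto intro!: Bochner_Integration.integrable_cong Bochner_Integration.integral_cong)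
  then show ?thesis by (simp add: has_weak_integral_def)
qed

text \<open>Self-adjointness moves the outer \<open>S\<close> to the second slot, leaving the weak
  integral of \<open>F\<close> at the vectors \<open>S x\<close> and \<open>S y\<close>.\<close>

lemma has_weak_integral_congruence:
  assumes "has_weak_integral \<mu> F T" "selfadjoint S" "complex_linear_op S"
  shows "has_weak_integral \<mu> (\<lambda>t. S o\<^sub>L F t o\<^sub>L S) (S o\<^sub>L T o\<^sub>L S)"
  using assms(1) unfolding has_weak_integral_def
  by (simp add: cinner_selfadjoint[OF assms(3,2)])

context finite_measure_unit_interval
begin

text \<open>The function \<open>g\<close> of the introduction, built from the measure alone;
  \<open>transpose_fun_eq\<close> identifies it with the transpose of \<open>f\<close>.\<close>

definition harmonic_average :: "real \<Rightarrow> real" where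
  "harmonic_average x = (LINT t|\<mu>. harmonic_fun t x)"

lemma integrable_harmonic_fun:
  assumes "0 \<le> x"
  shows "integrable \<mu> (\<lambda>t. harmonic_fun t x)"
proof (rule integrable_if_bounded)
  show "(\<lambda>t. harmonic_fun t x) \<in> borel_measurable borel"
    unfolding harmonic_fun_def by measurable
  show "\<bar>harmonic_fun t x\<bar> \<le> max 1 x" if "t \<in> {0..1}" for t
    using harmonic_fun_bounds[of t x "max 1 x"] assms that by auto
qed

lemma integral_harmonic_error_tendsto_0:
  assumes "1 \<le> M"
  shows "(\<lambda>n. LINT t|\<mu>. harmonic_error M n t) \<longlonglongrightarrow> 0"
proof -
  have "(\<lambda>n. LINT t|\<mu>. harmonic_error M n t) \<longlonglongrightarrow> (LINT t|\<mu>. 0)"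
  proof (rule integral_dominated_convergence[where w = "\<lambda>_. M"])
    show "harmonic_error M n \<in> borel_measurable \<mu>" for n
      by (rule borel_measurable_if_borel) (unfold harmonic_error_def[abs_def], measurable)
  qed (use assms in \<open>auto simp: space_eq harmonic_error_tendsto_0 harmonic_error_bounds\<close>)
  then show ?thesis by simp
qed

lemma integrable_harmonic_error:
  assumes "1 \<le> M"
  shows "integrable \<mu> (harmonic_error M n)"
proof (rule integrable_if_bounded)
  show "harmonic_error M n \<in> borel_measurable borel"
    unfolding harmonic_error_def[abs_def] by measurable
qed (use harmonic_error_bounds assms in auto)

text \<open>Averaging the Neumann polynomials over \<open>\<mu>\<close> gives polynomials
  \<open>q n\<close>. The integrated error \<open>?d n\<close> bounds their distance to
  \<open>harmonic_average\<close> on the interval and also the distance of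
  \<open>poly_op (q n) B\<close> to \<open>T\<close>; dominated convergence sends it to 0.\<close>

lemma fcalc_harmonic_average:
  assumes B: "positive_op B" "norm B \<le> M" and M: "1 \<le> M"
    and T: "has_weak_integral \<mu> (\<lambda>t. weighted_harmonic_mean t B id_blinfun) T"
  shows "fcalc B M harmonic_average T"
proof -
  let ?H = "\<lambda>t. weighted_harmonic_mean t B id_blinfun"
  let ?d = "\<lambda>n. LINT t|\<mu>. harmonic_error M n t"
  have "\<exists>q. \<forall>L. poly_linear L \<longrightarrow> integrable \<mu> (\<lambda>t. L (harmonic_approx M n t)) \<and>
      (LINT t|\<mu>. L (harmonic_approx M n t)) = L q" for n
    using averages_to_poly_harmonic_approx[OF M, of n, unfolded averages_to_poly_def,
        rule_format, of "\<lambda>_. 1"] by auto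
  then obtain q where q: "\<And>n L. poly_linear L \<Longrightarrow> integrable \<mu> (\<lambda>t. L (harmonic_approx M n t))"
      "\<And>n L. poly_linear L \<Longrightarrow> (LINT t|\<mu>. L (harmonic_approx M n t)) = L (q n)"
    by metis
  have scalar: "\<bar>poly (q n) x - harmonic_average x\<bar> \<le> ?d n" if x: "x \<in> {0..M}" for n x
  proof -
    have L: "poly_linear (\<lambda>p. poly p x)" by (simp add: poly_linear_def)
    have "poly (q n) x - harmonic_average x
        = (LINT t|\<mu>. poly (harmonic_approx M n t) x - harmonic_fun t x)"
      using q[OF L, of n] x integrable_harmonic_fun by (simp add: harmonic_average_def)
    also have "\<bar>\<dots>\<bar> \<le> (LINT t|\<mu>. \<bar>poly (harmonic_approx M n t) x - harmonic_fun t x\<bar>)"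
      by (rule integral_abs_bound)
    also have "\<dots> \<le> ?d n"
    proof (rule integral_mono)
      show "integrable \<mu> (\<lambda>t. \<bar>poly (harmonic_approx M n t) x - harmonic_fun t x\<bar>)"
        using q(1)[OF L, of n] x integrable_harmonic_fun by auto
    qed (use x M integrable_harmonic_error harmonic_approx_le in \<open>auto simp: space_eq\<close>)
    finally show ?thesis .
  qed
  have operator: "norm (poly_op (q n) B - T) \<le> ?d n" for n
  proof (rule norm_blinfun_bound)
    show "0 \<le> ?d n" using scalar[of 0 n] M by simp
    fix u
    \<comment> \<open>Testing the weak integral against the error vector itself produces the square
      of its norm.\<close>
    define v where "v = (poly_op (q n) B - T) u"
    let ?D = "\<lambda>t. poly_op (harmonic_approx M n t) B - ?H t"
    have L: "poly_linear (\<lambda>p. rinner (poly_op p B u) v)"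
      by (simp add: poly_linear_def poly_op_add poly_op_smult blinfun.bilinear_simps
          rinner.add_left rinner.scaleR_left)
    have int: "integrable \<mu> (\<lambda>t. rinner (?D t u) v)"
      using q(1)[OF L, of n] has_weak_integral_rinner(1)[OF T, of u v]
      by (simp add: blinfun.diff_left rinner.diff_left)
    have "(norm v)\<^sup>2 = (LINT t|\<mu>. rinner (?D t u) v)"
      using q[OF L, of n] has_weak_integral_rinner[OF T, of u v]
      by (simp add: rinner_self[symmetric] blinfun.diff_left rinner.diff_left) (simp add: v_def
          blinfun.diff_left rinner.diff_left)
    also have "\<dots> \<le> (LINT t|\<mu>. harmonic_error M n t * (norm u * norm v))"
    proof (rule integral_mono[OF int])
      fix t assume "t \<in> space \<mu>"
      then have t: "0 \<le> t" "t \<le> 1" by (auto simp: space_eq)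
      have "fcalc B M (\<lambda>x. poly (harmonic_approx M n t) x - harmonic_fun t x) (?D t)"
        by (intro fcalc_diff fcalc_poly fcalc_weighted_harmonic_mean B t)
      then have "norm (?D t) \<le> harmonic_error M n t"
        using harmonic_approx_le[OF t] M by (intro fcalc_norm_le[OF B]) auto
      have "rinner (?D t u) v \<le> norm (?D t u) * norm v"
        using rinner_Cauchy_Schwarz[of "?D t u" v] by linarith
      also have "\<dots> \<le> (harmonic_error M n t * norm u) * norm v"
        using order_trans[OF norm_blinfun mult_right_mono[OF \<open>norm (?D t) \<le> _\<close> norm_ge_zero]]
        by (intro mult_right_mono) auto
      finally show "rinner (?D t u) v \<le> harmonic_error M n t * (norm u * norm v)"
        by (simp add: mult.assoc)
    qed (use integrable_harmonic_error[OF M] in auto)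
    also have "\<dots> = ?d n * norm u * norm v" by simp
    finally have "norm v * norm v \<le> ?d n * norm u * norm v" by (simp add: power2_eq_square)
    then have "norm v \<le> ?d n * norm u"
      using \<open>0 \<le> ?d n\<close> by (cases "v = 0") auto
    then show "norm ((poly_op (q n) B - T) u) \<le> ?d n * norm u" by (simp add: v_def)
  qed
  note lim = integral_harmonic_error_tendsto_0[OF M]
  have "uniform_limit {0..M} (\<lambda>n. poly (q n)) harmonic_average sequentially"
  proof (rule uniform_limitI)
    fix e :: real assume "e > 0"
    then have "\<forall>\<^sub>F n in sequentially. ?d n < e"
      using order_tendstoD(2)[OF lim] by blast
    then show "\<forall>\<^sub>F n in sequentially. \<forall>x\<in>{0..M}. dist (poly (q n) x) (harmonic_average x) < e"
    proof eventually_elim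
      case (elim n)
      then show ?case using scalar[of _ n] by (fastforce simp: dist_real_def)
    qed
  qed
  moreover have "(\<lambda>n. poly_op (q n) B) \<longlonglongrightarrow> T"
    by (rule LIM_zero_cancel, rule Lim_null_comparison[OF _ lim]) (simp add: operator)
  ultimately show ?thesis unfolding fcalc_def by blast
qed

text \<open>The integrand of the difference is nonnegative and vanishes only at
  \<open>t = 1\<close>, so a zero integral would concentrate \<open>\<mu>\<close> at 1.\<close>

lemma harmonic_average_strict_mono:
  assumes "\<not> (AE t in \<mu>. t = 1)" "0 \<le> x" "x < y"
  shows "harmonic_average x < harmonic_average y"
proof -
  have lt: "harmonic_fun t x < harmonic_fun t y" if "0 \<le> t" "t < 1" for t
  proof -
    have "x * (1 - t) < y * (1 - t)" using assms that by (intro mult_strict_right_mono) auto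
    then show ?thesis
      using harmonic_denominator_pos[OF that, of x] harmonic_denominator_pos[OF that, of y] assms that
      by (simp add: harmonic_fun_def divide_less_eq less_divide_eq field_simps)
  qed
  let ?D = "\<lambda>t. harmonic_fun t y - harmonic_fun t x"
  have int: "integrable \<mu> ?D" using integrable_harmonic_fun assms by auto
  have nonneg: "0 \<le> ?D t" if "t \<in> space \<mu>" for t
    using lt[of t] that by (cases "t = 1") (auto simp: space_eq harmonic_fun_def)
  have "integral\<^sup>L \<mu> ?D \<noteq> 0"
  proof
    assume "integral\<^sup>L \<mu> ?D = 0"
    then have "AE t in \<mu>. ?D t = 0"
      using integral_nonneg_eq_0_iff_AE[OF int] nonneg by auto
    moreover have "AE t in \<mu>. t \<in> space \<mu>" by (rule AE_space)
    ultimately have "AE t in \<mu>. t = 1"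
      by eventually_elim (use lt in \<open>force simp: space_eq\<close>)
    with assms(1) show False by contradiction
  qed
  moreover have "0 \<le> integral\<^sup>L \<mu> ?D" by (intro Bochner_Integration.integral_nonneg nonneg)
  moreover have "integral\<^sup>L \<mu> ?D = harmonic_average y - harmonic_average x"
    using integrable_harmonic_fun assms by (simp add: harmonic_average_def)
  ultimately show ?thesis by simp
qed

text \<open>Translates (6) into the form used by the integrals; conversely, the scalar is recovered
  as the mass of the point 1.\<close>

lemma scale_return_iff_AE:
  "(\<exists>k\<ge>0. \<mu> = scale_measure (ennreal k) (return borel01 1)) \<longleftrightarrow> (AE t in \<mu>. t = 1)"
proof
  have [measurable]: "{0..<1} \<in> sets \<mu>"
    unfolding sets_eq by (auto simp: sets_restrict_space_iff)
  assume "\<exists>k\<ge>0. \<mu> = scale_measure (ennreal k) (return borel01 1)"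
  then obtain k where k: "\<mu> = scale_measure (ennreal k) (return borel01 1)" by blast
  have "emeasure \<mu> {0..<1} = 0"
    using \<open>{0..<1} \<in> sets \<mu>\<close> unfolding sets_eq by (subst k) simp
  then show "AE t in \<mu>. t = 1"
    by (intro AE_I[of _ _ "{0..<1}"]) (auto simp: space_eq)
next
  assume AE: "AE t in \<mu>. t = 1"
  have [measurable]: "{1} \<in> sets \<mu>"
    unfolding sets_eq by (auto simp: sets_restrict_space_iff)
  have "\<mu> = scale_measure (ennreal (measure \<mu> {1})) (return borel01 1)"
  proof (rule measure_eqI)
    fix A assume A: "A \<in> sets \<mu>"
    have "emeasure \<mu> A = emeasure \<mu> (A \<inter> {1})"
      using AE A by (intro emeasure_eq_AE) auto
    also have "\<dots> = emeasure \<mu> {1} * indicator A 1" by (cases "1 \<in> A") auto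
    finally show "emeasure \<mu> A = emeasure (scale_measure (ennreal (measure \<mu> {1})) (return borel01 1)) A"
      using A by (simp add: sets_eq emeasure_eq_measure)
  qed (simp add: sets_eq)
  then show "\<exists>k\<ge>0. \<mu> = scale_measure (ennreal k) (return borel01 1)"
    by (intro exI[of _ "measure \<mu> {1}"]) simp
qed

end

section \<open>Cancellability\<close>

text \<open>The inverse of \<open>g\<close> is continuous on the compact image, so polynomials
  \<open>p n\<close> approximate it there. The operators \<open>poly_op (p n) T\<close> depend on
  \<open>T\<close> alone, yet converge both to \<open>B\<close> and to \<open>C\<close>.\<close>

lemma fcalc_inj:
  assumes B: "positive_op B" "norm B \<le> M" and C: "positive_op C" "norm C \<le> M"
    and T: "fcalc B M g T" "fcalc C M g T" and inj: "inj_on g {0..M}"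
  shows "B = C"
proof -
  let ?\<phi> = "the_inv_into {0..M} g"
  note cont = continuous_on_fcalc[OF T(1)]
  obtain p where p: "uniform_limit (g ` {0..M}) (\<lambda>n. poly (p n)) ?\<phi> sequentially"
    using uniform_poly_approx[OF compact_continuous_image[OF cont compact_Icc]
        continuous_on_inv_into[OF cont compact_Icc inj]] by blast
  have "(\<lambda>n. poly_op (p n) T) \<longlonglongrightarrow> A" if A: "positive_op A" "norm A \<le> M" "fcalc A M g T" for A
  proof (rule tendstoI)
    fix e :: real assume "e > 0"
    then have "\<forall>\<^sub>F n in sequentially. \<forall>y\<in>g ` {0..M}. dist (poly (p n) y) (?\<phi> y) < e / 2"
      by (intro uniform_limitD[OF p]) simp
    then show "\<forall>\<^sub>F n in sequentially. dist (poly_op (p n) T) A < e"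
    proof eventually_elim
      case (elim n)
      have "norm (poly_op (p n) T - A) \<le> e / 2"
      proof (rule fcalc_norm_le[OF A(1,2)])
        show "fcalc A M (\<lambda>x. poly (p n) (g x) - x) (poly_op (p n) T - A)"
          by (intro fcalc_diff fcalc_poly_compose fcalc_ident A)
        show "\<bar>poly (p n) (g x) - x\<bar> \<le> e / 2" if "x \<in> {0..M}" for x
          using bspec[OF elim imageI[OF that]] the_inv_into_f_f[OF inj that]
          by (simp add: dist_real_def)
      qed
      then show ?case using \<open>e > 0\<close> by (simp add: dist_norm)
    qed
  qed
  then show ?thesis using LIMSEQ_unique assms by blast
qed

lemma associated_measureD:
  assumes "associated_measure \<sigma> \<mu>"
  shows "finite_measure_unit_interval \<mu>"
    "positive_op A \<Longrightarrow> positive_op B \<Longrightarrow>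
      has_weak_integral \<mu> (\<lambda>t. weighted_harmonic_mean t A B) (\<sigma> A B)"
  using assms
  by (auto simp: associated_measure_def finite_measure_unit_interval_def
      finite_measure_unit_interval_axioms_def)

text \<open>For invertible \<open>S\<close> the inequality (M2) becomes an equality, because it does
  so for each harmonic mean under the integral.\<close>

lemma associated_measure_congruence:
  assumes \<mu>: "associated_measure \<sigma> \<mu>" and B: "positive_op B"
    and S: "S' o\<^sub>L S = id_blinfun" "S o\<^sub>L S' = id_blinfun" "selfadjoint S" "complex_linear_op S"
  shows "\<sigma> (S o\<^sub>L B o\<^sub>L S) (S o\<^sub>L S) = S o\<^sub>L \<sigma> B id_blinfun o\<^sub>L S"
proof -
  interpret finite_measure_unit_interval \<mu> by (rule associated_measureD[OF \<mu>])
  have "S o\<^sub>L id_blinfun o\<^sub>L S = S o\<^sub>L S" by (auto intro: blinfun_eqI)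
  then have "positive_op (S o\<^sub>L S)"
    using positive_op_congruence[OF positive_op_id S(3,4)] by simp
  then have "has_weak_integral \<mu> (\<lambda>t. weighted_harmonic_mean t (S o\<^sub>L B o\<^sub>L S) (S o\<^sub>L S))
      (\<sigma> (S o\<^sub>L B o\<^sub>L S) (S o\<^sub>L S))"
    by (intro associated_measureD(2)[OF \<mu>] positive_op_congruence B S)
  moreover have "weighted_harmonic_mean t (S o\<^sub>L B o\<^sub>L S) (S o\<^sub>L S)
      = S o\<^sub>L weighted_harmonic_mean t B id_blinfun o\<^sub>L S" if "t \<in> space \<mu>" for t
    using that by (intro weighted_harmonic_mean_congruence[OF B _ _ S]) (auto simp: space_eq)
  ultimately have "has_weak_integral \<mu> (\<lambda>t. S o\<^sub>L weighted_harmonic_mean t B id_blinfun o\<^sub>L S)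
      (\<sigma> (S o\<^sub>L B o\<^sub>L S) (S o\<^sub>L S))"
    by (simp cong: has_weak_integral_cong)
  moreover have "has_weak_integral \<mu> (\<lambda>t. S o\<^sub>L weighted_harmonic_mean t B id_blinfun o\<^sub>L S)
      (S o\<^sub>L \<sigma> B id_blinfun o\<^sub>L S)"
    by (intro has_weak_integral_congruence associated_measureD(2)[OF \<mu>] B positive_op_id S)
  ultimately show ?thesis by (rule has_weak_integral_unique)
qed

lemma right_cancellable_if_not_AE:
  assumes \<mu>: "associated_measure \<sigma> \<mu>" and not_AE: "\<not> (AE t in \<mu>. t = 1)"
  shows "right_cancellable \<sigma>"
  unfolding right_cancellable_def
proof (intro allI impI)
  interpret finite_measure_unit_interval \<mu> by (rule associated_measureD[OF \<mu>])
  fix A B C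
  assume A: "strictly_positive_op A" and B: "positive_op B" and C: "positive_op C"
    and eq: "\<sigma> B A = \<sigma> C A"
  obtain S S' where A_eq: "A = S o\<^sub>L S" and S: "S' o\<^sub>L S = id_blinfun" "S o\<^sub>L S' = id_blinfun"
    "selfadjoint S" "complex_linear_op S"
    using strictly_positive_op_sqrt[OF A] by blast
  note simps = S(1,2)[THEN inverse_op_apply]
  have S': "selfadjoint S'" "complex_linear_op S'"
    using selfadjoint_inverse[OF S(3,1,2)] complex_linear_op_inverse[OF S(4,1,2)] by auto
  \<comment> \<open>Undoing the congruence on the left arguments makes the identity the common right
    argument.\<close>
  define B' where "B' = S' o\<^sub>L B o\<^sub>L S'"
  define C' where "C' = S' o\<^sub>L C o\<^sub>L S'"
  have pos: "positive_op B'" "positive_op C'"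
    unfolding B'_def C'_def by (intro positive_op_congruence B C S')+
  have BC: "B = S o\<^sub>L B' o\<^sub>L S" "C = S o\<^sub>L C' o\<^sub>L S"
    by (auto intro!: blinfun_eqI simp: B'_def C'_def simps)
  have "S o\<^sub>L \<sigma> B' id_blinfun o\<^sub>L S = S o\<^sub>L \<sigma> C' id_blinfun o\<^sub>L S"
    using eq associated_measure_congruence[OF \<mu> pos(1) S] associated_measure_congruence[OF \<mu> pos(2) S]
    unfolding BC A_eq by simp
  then have "S' ((S o\<^sub>L \<sigma> B' id_blinfun o\<^sub>L S) (S' x)) = S' ((S o\<^sub>L \<sigma> C' id_blinfun o\<^sub>L S) (S' x))" for x
    by simp
  then have T: "\<sigma> B' id_blinfun = \<sigma> C' id_blinfun"
    by (intro blinfun_eqI) (simp add: simps)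
  \<comment> \<open>One interval serves both operators; the calculus of
    \<open>harmonic_average\<close> asks for a length of at least 1.\<close>
  define M where "M = max 1 (max (norm B') (norm C'))"
  have M: "1 \<le> M" "norm B' \<le> M" "norm C' \<le> M" by (auto simp: M_def)
  have fcalc: "fcalc D M harmonic_average (\<sigma> D id_blinfun)" if "positive_op D" "norm D \<le> M" for D
    using that M(1) by (intro fcalc_harmonic_average associated_measureD(2)[OF \<mu>] positive_op_id)
  have "fcalc B' M harmonic_average (\<sigma> C' id_blinfun)"
    "fcalc C' M harmonic_average (\<sigma> C' id_blinfun)"
    using fcalc[OF pos(1) M(2)] fcalc[OF pos(2) M(3)] by (simp_all add: T)
  moreover have "inj_on harmonic_average {0..M}"
    by (intro strict_mono_on_imp_inj_on strict_mono_onI harmonic_average_strict_mono not_AE) auto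
  ultimately have "B' = C'"
    using fcalc_inj pos M(2,3) by blast
  then show "B = C" using BC by simp
qed

lemma associated_measure_right_trivial:
  assumes \<mu>: "associated_measure \<sigma> \<mu>" and AE: "AE t in \<mu>. t = 1"
    and A: "positive_op A" and B: "positive_op B"
  shows "\<sigma> A B = measure \<mu> (space \<mu>) *\<^sub>R B"
proof (intro blinfun_eqI eq_if_rinner_eq)
  fix x y
  interpret finite_measure_unit_interval \<mu> by (rule associated_measureD[OF \<mu>])
  note int = has_weak_integral_rinner[OF associated_measureD(2)[OF \<mu> A B], of x y]
  have "rinner (\<sigma> A B x) y = (LINT t|\<mu>. rinner (weighted_harmonic_mean t A B x) y)"
    using int by simp
  also have "\<dots> = (LINT t|\<mu>. rinner (B x) y)"
  proof (rule integral_cong_AE)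
    show "AE t in \<mu>. rinner (weighted_harmonic_mean t A B x) y = rinner (B x) y"
      using AE by eventually_elim (simp add: weighted_harmonic_mean_1[OF A B])
  qed (use int in auto)
  also have "\<dots> = rinner ((measure \<mu> (space \<mu>) *\<^sub>R B) x) y"
    by (simp add: blinfun.scaleR_left rinner.scaleR_left)
  finally show "rinner (\<sigma> A B x) y = rinner ((measure \<mu> (space \<mu>) *\<^sub>R B) x) y" .
qed

section \<open>The representing function and its transpose\<close>

text \<open>Testing the weak integral at a nonzero vector reads off the scalars in front of the
  identity.\<close>

lemma representing_function_eq:
  fixes \<sigma> :: "('a::chilbert_space \<Rightarrow>\<^sub>L 'a) \<Rightarrow> ('a \<Rightarrow>\<^sub>L 'a) \<Rightarrow> ('a \<Rightarrow>\<^sub>L 'a)"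
  assumes nz: "\<exists>x::'a. x \<noteq> 0" and f: "representing_function \<sigma> f"
    and \<mu>: "associated_measure \<sigma> \<mu>" and x: "x > 0"
  shows "f x = x * finite_measure_unit_interval.harmonic_average \<mu> (1 / x)"
proof -
  interpret finite_measure_unit_interval \<mu> by (rule associated_measureD[OF \<mu>])
  obtain v :: 'a where v: "v \<noteq> 0" using nz by blast
  let ?I = "id_blinfun :: 'a \<Rightarrow>\<^sub>L 'a"
  have "f x *\<^sub>R ?I = \<sigma> ?I (x *\<^sub>R ?I)"
    using f x by (simp add: representing_function_def)
  then have W: "has_weak_integral \<mu> (\<lambda>t. weighted_harmonic_mean t ?I (x *\<^sub>R ?I)) (f x *\<^sub>R ?I)"
    using associated_measureD(2)[OF \<mu> positive_op_id positive_op_scaleR[OF positive_op_id]] x by simp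
  have "f x * (norm v)\<^sup>2 = (LINT t|\<mu>. rinner (weighted_harmonic_mean t ?I (x *\<^sub>R ?I) v) v)"
    using has_weak_integral_rinner(2)[OF W, of v v]
    by (simp add: blinfun.scaleR_left rinner.scaleR_left rinner_self)
  also have "\<dots> = (LINT t|\<mu>. x * harmonic_fun t (1 / x) * (norm v)\<^sup>2)"
    using x by (intro Bochner_Integration.integral_cong refl)
      (simp add: space_eq weighted_harmonic_mean_id_scaleR blinfun.scaleR_left rinner.scaleR_left rinner_self)
  also have "\<dots> = x * harmonic_average (1 / x) * (norm v)\<^sup>2"
    by (simp add: harmonic_average_def)
  finally show ?thesis using v by simp
qed

lemma transpose_fun_eq:
  fixes \<sigma> :: "('a::chilbert_space \<Rightarrow>\<^sub>L 'a) \<Rightarrow> ('a \<Rightarrow>\<^sub>L 'a) \<Rightarrow> ('a \<Rightarrow>\<^sub>L 'a)"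
  assumes nz: "\<exists>x::'a. x \<noteq> 0" and f: "representing_function \<sigma> f"
    and \<mu>: "associated_measure \<sigma> \<mu>" and "x \<ge> 0"
  shows "transpose_fun f x = finite_measure_unit_interval.harmonic_average \<mu> x"
proof -
  interpret finite_measure_unit_interval \<mu> by (rule associated_measureD[OF \<mu>])
  have eq: "y * f (1 / y) = harmonic_average y" if "y > 0" for y
    using representing_function_eq[OF nz f \<mu>, of "1 / y"] that by simp
  show ?thesis
  proof (cases "x = 0")
    case True
    have pos0: "positive_op (0 :: 'a \<Rightarrow>\<^sub>L 'a)"
      using positive_op_scaleR[OF positive_op_id, of 0] by simp
    \<comment> \<open>The calculus at the zero operator serves to show that
      \<open>harmonic_average\<close> is continuous at 0, where the transpose is defined by a
      limit.\<close>
    have "fcalc 0 1 harmonic_average (\<sigma> 0 id_blinfun)"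
      by (intro fcalc_harmonic_average pos0 positive_op_id associated_measureD(2)[OF \<mu>]) auto
    then have "continuous_on {0..1} harmonic_average"
      by (rule continuous_on_fcalc)
    then have "(harmonic_average \<longlongrightarrow> harmonic_average 0) (at_right 0)"
      by (rule continuous_on_Icc_at_rightD) simp
    moreover have "\<forall>\<^sub>F y in at_right 0. harmonic_average y = y * f (1 / y)"
      using eventually_at_right_less by eventually_elim (simp add: eq)
    ultimately have "((\<lambda>y. y * f (1 / y)) \<longlongrightarrow> harmonic_average 0) (at_right 0)"
      using tendsto_cong by fastforce
    then show ?thesis
      using True by (simp add: transpose_fun_def tendsto_Lim)
  qed (use assms(4) eq in \<open>simp add: transpose_fun_def\<close>)
qed

theorem theorem2p4:
  fixes \<sigma> :: "('a::chilbert_space \<Rightarrow>\<^sub>L 'a) \<Rightarrow> ('a \<Rightarrow>\<^sub>L 'a) \<Rightarrow> ('a \<Rightarrow>\<^sub>L 'a)"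
    and f :: "real \<Rightarrow> real" and \<mu> :: "real measure"
  assumes "\<exists>x::'a. x \<noteq> 0"
    and "connection \<sigma>"
    and "representing_function \<sigma> f"
    and "associated_measure \<sigma> \<mu>"
  shows
    "(right_cancellable \<sigma> \<longleftrightarrow>
        (\<forall>A B. positive_op A \<longrightarrow> positive_op B \<longrightarrow>
           \<sigma> A id_blinfun = \<sigma> B id_blinfun \<longrightarrow> A = B)) \<and>
     (right_cancellable \<sigma> \<longleftrightarrow>
        \<not> (\<exists>k\<ge>0::real. \<forall>A B. positive_op A \<longrightarrow> positive_op B \<longrightarrow> \<sigma> A B = k *\<^sub>R B)) \<and>
     (right_cancellable \<sigma> \<longleftrightarrow> inj_on (transpose_fun f) {0..}) \<and>
     (right_cancellable \<sigma> \<longleftrightarrow> \<not> (\<exists>k::real. \<forall>x\<ge>0. f x = k * x)) \<and>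
     (right_cancellable \<sigma> \<longleftrightarrow>
        \<not> (\<exists>k\<ge>0::real. \<mu> = scale_measure (ennreal k) (return borel01 1)))"
    (is "(?R \<longleftrightarrow> ?c2) \<and> (_ \<longleftrightarrow> \<not> ?nc3) \<and> (_ \<longleftrightarrow> ?c4) \<and> (_ \<longleftrightarrow> \<not> ?nc5) \<and> (_ \<longleftrightarrow> \<not> ?nc6)")
proof -
  note \<mu> = assms(4)
  interpret finite_measure_unit_interval \<mu> by (rule associated_measureD[OF \<mu>])
  let ?I = "id_blinfun :: 'a \<Rightarrow>\<^sub>L 'a"
  obtain v :: 'a where v: "v \<noteq> 0" using assms(1) by blast
  have pos0: "positive_op (0 :: 'a \<Rightarrow>\<^sub>L 'a)"
    using positive_op_scaleR[OF positive_op_id, of 0] by simp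
  \<comment> \<open>In the zero space all operators coincide and (2) holds for every
    \<open>\<sigma>\<close>, so a nonzero vector is essential.\<close>
  have neq: "(0 :: 'a \<Rightarrow>\<^sub>L 'a) \<noteq> ?I"
    using v by (metis blinfun_apply_id_blinfun id_apply zero_blinfun.rep_eq)
  have "strictly_positive_op ?I"
    unfolding strictly_positive_op_def invertible_op_def
    by (auto intro!: positive_op_id exI[of _ ?I] blinfun_eqI)
  then have 12: "?R \<Longrightarrow> ?c2" unfolding right_cancellable_def by blast
  have 23: "\<not> ?nc3" if ?c2
  proof
    assume ?nc3
    then have "\<sigma> 0 ?I = \<sigma> ?I ?I" using pos0 positive_op_id by metis
    with that show False using pos0 positive_op_id neq by metis
  qed
  have 36: "?nc3" if "AE t in \<mu>. t = 1"
    using associated_measure_right_trivial[OF \<mu> that]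
    by (intro exI[of _ "measure \<mu> (space \<mu>)"]) simp
  have 61: ?R if "\<not> (AE t in \<mu>. t = 1)"
    using right_cancellable_if_not_AE[OF \<mu> that] .
  have 35: ?nc5 if nc3: ?nc3
  proof -
    obtain k where k: "\<And>A B. positive_op A \<Longrightarrow> positive_op B \<Longrightarrow> \<sigma> A B = k *\<^sub>R B"
      using nc3 by blast
    have "f x = k * x" if "x \<ge> 0" for x
    proof -
      have "f x *\<^sub>R ?I = \<sigma> ?I (x *\<^sub>R ?I)"
        using assms(3) that by (simp add: representing_function_def)
      also have "\<dots> = k *\<^sub>R (x *\<^sub>R ?I)"
        by (intro k positive_op_id positive_op_scaleR that)
      finally have "f x *\<^sub>R ?I = k *\<^sub>R (x *\<^sub>R ?I)" .
      then have "(f x *\<^sub>R ?I) v = (k *\<^sub>R (x *\<^sub>R ?I)) v" by (simp only:)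
      then show ?thesis using v by (simp add: blinfun.scaleR_left)
    qed
    then show ?thesis by blast
  qed
  \<comment> \<open>The transpose of \<open>x \<mapsto> k * x\<close> is constant on the positive
    reals; 1 and 2 witness this.\<close>
  have 54: "\<not> ?c4" if nc5: ?nc5
  proof
    obtain k where "\<And>x. x \<ge> 0 \<Longrightarrow> f x = k * x" using nc5 by blast
    then have "transpose_fun f 1 = transpose_fun f 2" by (simp add: transpose_fun_def)
    moreover assume ?c4
    ultimately show False by (auto dest!: inj_onD)
  qed
  have 46: "?c4" if "\<not> (AE t in \<mu>. t = 1)"
  proof -
    have "inj_on harmonic_average {0..}"
      by (intro strict_mono_on_imp_inj_on strict_mono_onI harmonic_average_strict_mono that) auto
    then show ?thesis
      using transpose_fun_eq[OF assms(1,3,4)] by (simp add: inj_on_def)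
  qed
  \<comment> \<open>With (6) read as failure of \<open>t = 1\<close> almost everywhere, the
    implications form the cycles 1, 2, 3, 6, 1 and 6, 4, 5, 3, 6; those from 3 to 6 and from 4 to 5
    to 3 were shown by contraposition.\<close>
  show ?thesis
    using 12 23 36 61 35 54 46 scale_return_iff_AE by blast
qed

end
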